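(* Let $\Omega\subset\mathbb{H}$ be a circular domain and let $(1,I,J,K)$ be a basis of $\mathbb{H}$ (as a real vector space). The map $$(\mathcal{SEM}_{\mathbb{R}}(\Omega))^{4}\ni(f_{0},f_{1},f_{2},f_{3})\mapsto f_{0}+f_{1}I+f_{2}J+f_{3}K\in\mathcal{SEM}(\Omega)$$ is an $\mathcal{SEM}_{\mathbb{R}}(\Omega)$-linear isomorphism. In particular $\mathcal{SEM}(\Omega)$ is a $4$-dimensional vector space over the field $\mathcal{SEM}_{\mathbb{R}}(\Omega)$.
   Context: $\mathbb{H}$ denotes the quaternions, $\mathbb{S}=\{q\in\mathbb{H}: q^2=-1\}$, and $\mathbb{C}_I=\mathbb{R}+I\mathbb{R}$ for $I\in\mathbb{S}$. For $q=x+Iy$ put $\mathbb{S}_q=\{x+Jy: J\in\mathbb{S}\}$. A domain (connected open set) $\Omega\subset\mathbb{H}$ is circular if $\mathbb{S}_q\subset\Omega$ for all $q\in\Omega$. A function $f$ on a circular open set $\Omega$ is slice regular ($f\in\mathcal{SR}(\Omega)$) if $f(x+Iy)=F_1(x,y)+IF_2(x,y)$ for all $x+Iy\in\Omega$ ($x,y\in\mathbb{R}$, $I\in\mathbb{S}$), with $\mathbb{H}$-valued $F_1$ even in $y$ and $F_2$ odd in $y$, and each restriction $f|_{\Omega\cap\mathbb{C}_I}$ is real differentiable with $\frac12(\partial_x+I\partial_y)f|_{\Omega\cap\mathbb{C}_I}\equiv0$. The $*$-product is $(f*g)(q)=0$ if $f(q)=0$ and $(f*g)(q)=f(q)\,g(f(q)^{-1}qf(q))$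 otherwise; when $f$ is slice preserving, i.e. $f(\Omega\cap\mathbb{C}_I)\subset\mathbb{C}_I$ for every $I\in\mathbb{S}$, it is the pointwise product $fg$. A function $f$ is slice semi-regular on $\Omega$ ($f\in\mathcal{SEM}(\Omega)$) if there is a circular open $\widetilde\Omega\subseteq\Omega$ with $f\in\mathcal{SR}(\widetilde\Omega)$ and each point of $\Omega\setminus\widetilde\Omega$ is a pole or a removable singularity; i.e. $\Omega\setminus\widetilde\Omega$ consists of isolated real points and isolated spheres $\mathbb{S}_p$, near each of which $\Delta_p^m f$ extends slice regularly for some integer $m\ge0$, where $\Delta_p(q)=q^2-2\mathrm{Re}(p)q+|p|^2$. Functions agreeing where both are defined are identified. $\mathcal{SEM}_{\mathbb{R}}(\Omega)$ is the subset of slice preserving elements; it is a field, acting on $\mathcal{SEM}(\Omega)$ by $(\alpha,f)\mapsto\alpha f$. *)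

theory Defs
  imports "HOL-Analysis.Analysis" "HOL-Algebra.Module"
begin

section \<open>Quaternions\<close>

datatype quat = Quat (qRe: real) (qIm1: real) (qIm2: real) (qIm3: real)

lemma quat_eq_iff:
  "p = q \<longleftrightarrow> qRe p = qRe q \<and> qIm1 p = qIm1 q \<and> qIm2 p = qIm2 q \<and> qIm3 p = qIm3 q"
  by (cases p; cases q) auto

instantiation quat :: real_algebra_1
begin

definition zero_quat :: quat where "0 = Quat 0 0 0 0"
definition one_quat :: quat where "1 = Quat 1 0 0 0"
definition plus_quat :: "quat \<Rightarrow> quat \<Rightarrow> quat" where
  "p + q = Quat (qRe p + qRe q) (qIm1 p + qIm1 q) (qIm2 p + qIm2 q) (qIm3 p + qIm3 q)"
definition minus_quat :: "quat \<Rightarrow> quat \<Rightarrow> quat" where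
  "p - q = Quat (qRe p - qRe q) (qIm1 p - qIm1 q) (qIm2 p - qIm2 q) (qIm3 p - qIm3 q)"
definition uminus_quat :: "quat \<Rightarrow> quat" where
  "- p = Quat (- qRe p) (- qIm1 p) (- qIm2 p) (- qIm3 p)"
definition scaleR_quat :: "real \<Rightarrow> quat \<Rightarrow> quat" where
  "r *\<^sub>R p = Quat (r * qRe p) (r * qIm1 p) (r * qIm2 p) (r * qIm3 p)"
definition times_quat :: "quat \<Rightarrow> quat \<Rightarrow> quat" where
  "p * q = Quat
     (qRe p * qRe q - qIm1 p * qIm1 q - qIm2 p * qIm2 q - qIm3 p * qIm3 q)
     (qRe p * qIm1 q + qIm1 p * qRe q + qIm2 p * qIm3 q - qIm3 p * qIm2 q)
     (qRe p * qIm2 q - qIm1 p * qIm3 q + qIm2 p * qRe q + qIm3 p * qIm1 q)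
     (qRe p * qIm3 q + qIm1 p * qIm2 q - qIm2 p * qIm1 q + qIm3 p * qRe q)"

lemmas quat_ops_defs = zero_quat_def one_quat_def plus_quat_def minus_quat_def
  uminus_quat_def scaleR_quat_def times_quat_def

instance
  by standard (simp_all add: quat_ops_defs algebra_simps)

end

instantiation quat :: real_inner
begin

definition inner_quat :: "quat \<Rightarrow> quat \<Rightarrow> real" where
  "p \<bullet> q = qRe p * qRe q + qIm1 p * qIm1 q + qIm2 p * qIm2 q + qIm3 p * qIm3 q"
definition norm_quat :: "quat \<Rightarrow> real" where
  "norm (p::quat) = sqrt (p \<bullet> p)"
definition sgn_quat :: "quat \<Rightarrow> quat" where
  "sgn (p::quat) = p /\<^sub>R norm p"
definition dist_quat :: "quat \<Rightarrow> quat \<Rightarrow> real" where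
  "dist p q = norm (p - q :: quat)"
definition uniformity_quat :: "(quat \<times> quat) filter" where
  "uniformity = (INF e\<in>{0 <..}. principal {(p, q :: quat). dist p q < e})"
definition open_quat :: "quat set \<Rightarrow> bool" where
  "open (U :: quat set) \<longleftrightarrow>
     (\<forall>p\<in>U. eventually (\<lambda>(p', q). p' = p \<longrightarrow> q \<in> U) uniformity)"

instance
proof
  fix p q r :: quat and a :: real
  show "(p \<bullet> p = 0) = (p = 0)"
  proof
    assume "p \<bullet> p = 0"
    then have "(qRe p)\<^sup>2 + (qIm1 p)\<^sup>2 + (qIm2 p)\<^sup>2 + (qIm3 p)\<^sup>2 = 0"
      by (simp add: inner_quat_def power2_eq_square)
    then have "(qRe p)\<^sup>2 = 0 \<and> (qIm1 p)\<^sup>2 = 0 \<and> (qIm2 p)\<^sup>2 = 0 \<and> (qIm3 p)\<^sup>2 = 0"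
      using zero_le_power2[of "qRe p"] zero_le_power2[of "qIm1 p"]
        zero_le_power2[of "qIm2 p"] zero_le_power2[of "qIm3 p"] by linarith
    then show "p = 0" by (simp add: quat_eq_iff zero_quat_def)
  qed (simp add: inner_quat_def zero_quat_def)
qed (simp_all add: inner_quat_def norm_quat_def sgn_quat_def dist_quat_def
      uniformity_quat_def open_quat_def quat_ops_defs algebra_simps)

end

instantiation quat :: real_normed_div_algebra
begin

definition inverse_quat :: "quat \<Rightarrow> quat" where
  "inverse p = Quat (qRe p) (- qIm1 p) (- qIm2 p) (- qIm3 p) /\<^sub>R (p \<bullet> p)"
definition divide_quat :: "quat \<Rightarrow> quat \<Rightarrow> quat" where
  "divide_quat p q = p * inverse q"

instance
proof
  fix p q :: quat
  show "inverse p * p = 1" "p * inverse p = 1" if "p \<noteq> 0"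
  proof -
    have nz: "p \<bullet> p \<noteq> 0" using that by simp
    have "Quat (qRe p) (- qIm1 p) (- qIm2 p) (- qIm3 p) * p = (p \<bullet> p) *\<^sub>R 1"
      "p * Quat (qRe p) (- qIm1 p) (- qIm2 p) (- qIm3 p) = (p \<bullet> p) *\<^sub>R 1"
      by (simp_all add: quat_ops_defs inner_quat_def algebra_simps)
    then show "inverse p * p = 1" "p * inverse p = 1"
      using nz by (simp_all add: inverse_quat_def)
  qed
  show "p div q = p * inverse q" by (rule divide_quat_def)
  show "inverse (0 :: quat) = 0" by (simp add: inverse_quat_def quat_ops_defs)
  have "(p * q) \<bullet> (p * q) = (p \<bullet> p) * (q \<bullet> q)"
    by (simp add: inner_quat_def times_quat_def algebra_simps)
  then show "norm (p * q) = norm p * norm q"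
    by (simp add: norm_quat_def real_sqrt_mult)
qed

end


section \<open>Circular sets and slice regular functions\<close>

definition qunits :: "quat set" where
  "qunits = {q. q\<^sup>2 = - 1}"

definition slice_pt :: "quat \<Rightarrow> real \<Rightarrow> real \<Rightarrow> quat" where
  "slice_pt I x y = of_real x + I * of_real y"

definition slice :: "quat \<Rightarrow> quat set" where
  "slice I = {slice_pt I x y | x y. True}"

definition qsphere :: "quat \<Rightarrow> quat set" where
  "qsphere q = {slice_pt J x y | I J x y. I \<in> qunits \<and> J \<in> qunits \<and> q = slice_pt I x y}"

definition circular :: "quat set \<Rightarrow> bool" where
  "circular \<Omega> \<longleftrightarrow> (\<forall>q\<in>\<Omega>. qsphere q \<subseteq> \<Omega>)"

definition circular_domain :: "quat set \<Rightarrow> bool" where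
  "circular_domain \<Omega> \<longleftrightarrow> open \<Omega> \<and> connected \<Omega> \<and> \<Omega> \<noteq> {} \<and> circular \<Omega>"

text \<open>Slice regular functions are represented by total functions whose values outside
  \<open>\<Omega>\<close> are irrelevant. Since a circular set is invariant under \<open>y \<mapsto> - y\<close> in every slice,
  the stem components \<open>F1, F2\<close> may be taken to be total as well.\<close>

definition SR :: "quat set \<Rightarrow> (quat \<Rightarrow> quat) set" where
  "SR \<Omega> = {f. open \<Omega> \<and> circular \<Omega> \<and>
     (\<exists>F1 F2 :: real \<Rightarrow> real \<Rightarrow> quat.
        (\<forall>x y. F1 x (- y) = F1 x y \<and> F2 x (- y) = - F2 x y) \<and>
        (\<forall>I\<in>qunits. \<forall>x y. slice_pt I x y \<in> \<Omega> \<longrightarrow>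
           f (slice_pt I x y) = F1 x y + I * F2 x y)) \<and>
     (\<forall>I\<in>qunits. \<forall>x y. slice_pt I x y \<in> \<Omega> \<longrightarrow>
        (\<exists>f'. ((\<lambda>(s, t). f (slice_pt I s t)) has_derivative f') (at (x, y)) \<and>
              (1 / 2) *\<^sub>R (f' (1, 0) + I * f' (0, 1)) = 0))}"

definition slice_preserving :: "(quat \<Rightarrow> quat) \<Rightarrow> quat set \<Rightarrow> bool" where
  "slice_preserving f \<Omega> \<longleftrightarrow> (\<forall>I\<in>qunits. f ` (\<Omega> \<inter> slice I) \<subseteq> slice I)"


section \<open>Slice semi-regular functions\<close>

definition qDelta :: "quat \<Rightarrow> quat \<Rightarrow> quat" where
  "qDelta p q = q\<^sup>2 - of_real (2 * qRe p) * q + of_real ((norm p)\<^sup>2)"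

text \<open>A semi-regular function on \<open>\<Omega>\<close> is represented by a pair \<open>(U, f)\<close>, where \<open>f\<close> is slice
  regular on \<open>U\<close> and every sphere (or real point) of \<open>\<Omega> - U\<close> is isolated and is a pole or a
  removable singularity of \<open>f\<close>.\<close>

definition sem_reps :: "quat set \<Rightarrow> (quat set \<times> (quat \<Rightarrow> quat)) set" where
  "sem_reps \<Omega> = {(U, f). U \<subseteq> \<Omega> \<and> f \<in> SR U \<and>
     (\<forall>p\<in>\<Omega> - U. \<exists>N. open N \<and> circular N \<and> p \<in> N \<and> N \<subseteq> \<Omega> \<and> N - qsphere p \<subseteq> U \<and>
        (\<exists>(m::nat) g. g \<in> SR N \<and> (\<forall>q\<in>N - qsphere p. g q = qDelta p q ^ m * f q)))}"

definition sem_rel ::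
  "quat set \<Rightarrow> ((quat set \<times> (quat \<Rightarrow> quat)) \<times> (quat set \<times> (quat \<Rightarrow> quat))) set" where
  "sem_rel \<Omega> = {((U, f), (V, g)). (U, f) \<in> sem_reps \<Omega> \<and> (V, g) \<in> sem_reps \<Omega> \<and>
     (\<forall>q\<in>U \<inter> V. f q = g q)}"

type_synonym sem = "(quat set \<times> (quat \<Rightarrow> quat)) set"

definition sem_lift2 ::
  "quat set \<Rightarrow> (quat \<Rightarrow> quat \<Rightarrow> quat) \<Rightarrow> sem \<Rightarrow> sem \<Rightarrow> sem" where
  "sem_lift2 \<Omega> op A B =
     (\<Union>(U, f)\<in>A. \<Union>(V, g)\<in>B. sem_rel \<Omega> `` {(U \<inter> V, \<lambda>q. op (f q) (g q))})"

text \<open>Pointwise multiplication; it agrees with the \<open>*\<close>-product, and is used below, only when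
  the left factor is slice preserving.\<close>

abbreviation sem_mult :: "quat set \<Rightarrow> sem \<Rightarrow> sem \<Rightarrow> sem" where
  "sem_mult \<Omega> \<equiv> sem_lift2 \<Omega> (*)"

abbreviation sem_add :: "quat set \<Rightarrow> sem \<Rightarrow> sem \<Rightarrow> sem" where
  "sem_add \<Omega> \<equiv> sem_lift2 \<Omega> (+)"

definition sem_const :: "quat set \<Rightarrow> quat \<Rightarrow> sem" where
  "sem_const \<Omega> c = sem_rel \<Omega> `` {(\<Omega>, \<lambda>_. c)}"

definition SEM_R :: "quat set \<Rightarrow> sem ring" where
  "SEM_R \<Omega> =
     \<lparr>carrier = {A \<in> sem_reps \<Omega> // sem_rel \<Omega>. \<forall>(U, f)\<in>A. slice_preserving f U},
      monoid.mult = sem_mult \<Omega>, one = sem_const \<Omega> 1,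
      zero = sem_const \<Omega> 0, add = sem_add \<Omega>\<rparr>"

text \<open>The locale \<open>module\<close> ignores the fields \<open>mult\<close> and \<open>one\<close> of the module record.\<close>

definition SEM :: "quat set \<Rightarrow> (sem, sem) module" where
  "SEM \<Omega> =
     \<lparr>carrier = sem_reps \<Omega> // sem_rel \<Omega>,
      monoid.mult = undefined, one = undefined,
      zero = sem_const \<Omega> 0, add = sem_add \<Omega>,
      smult = sem_mult \<Omega>\<rparr>"


section \<open>Linear algebra over a field in the sense of HOL-Algebra\<close>

definition power4_module :: "'a ring \<Rightarrow> ('a, 'a \<times> 'a \<times> 'a \<times> 'a) module" where
  "power4_module R =
     \<lparr>carrier = carrier R \<times> carrier R \<times> carrier R \<times> carrier R,
      monoid.mult = undefined, one = undefined,
      zero = (\<zero>\<^bsub>R\<^esub>, \<zero>\<^bsub>R\<^esub>, \<zero>\<^bsub>R\<^esub>, \<zero>\<^bsub>R\<^esub>),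
      add = (\<lambda>(a0, a1, a2, a3) (b0, b1, b2, b3).
               (a0 \<oplus>\<^bsub>R\<^esub> b0, a1 \<oplus>\<^bsub>R\<^esub> b1, a2 \<oplus>\<^bsub>R\<^esub> b2, a3 \<oplus>\<^bsub>R\<^esub> b3)),
      smult = (\<lambda>r (a0, a1, a2, a3).
               (r \<otimes>\<^bsub>R\<^esub> a0, r \<otimes>\<^bsub>R\<^esub> a1, r \<otimes>\<^bsub>R\<^esub> a2, r \<otimes>\<^bsub>R\<^esub> a3))\<rparr>"

definition linear_isomorphism ::
  "'r ring \<Rightarrow> ('r, 'a) module \<Rightarrow> ('r, 'b) module \<Rightarrow> ('a \<Rightarrow> 'b) \<Rightarrow> bool" where
  "linear_isomorphism R M N h \<longleftrightarrow>
     Module.module R M \<and> Module.module R N \<and>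
     (\<forall>v\<in>carrier M. \<forall>w\<in>carrier M. h (v \<oplus>\<^bsub>M\<^esub> w) = h v \<oplus>\<^bsub>N\<^esub> h w) \<and>
     (\<forall>r\<in>carrier R. \<forall>v\<in>carrier M. h (r \<odot>\<^bsub>M\<^esub> v) = r \<odot>\<^bsub>N\<^esub> h v) \<and>
     bij_betw h (carrier M) (carrier N)"

definition module_basis :: "'r ring \<Rightarrow> ('r, 'a) module \<Rightarrow> 'a set \<Rightarrow> bool" where
  "module_basis R M B \<longleftrightarrow>
     finite B \<and> B \<subseteq> carrier M \<and>
     (\<forall>c\<in>B \<rightarrow> carrier R. (\<Oplus>\<^bsub>M\<^esub>b\<in>B. c b \<odot>\<^bsub>M\<^esub> b) = \<zero>\<^bsub>M\<^esub> \<longrightarrow> (\<forall>b\<in>B. c b = \<zero>\<^bsub>R\<^esub>)) \<and>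
     (\<forall>v\<in>carrier M. \<exists>c\<in>B \<rightarrow> carrier R. v = (\<Oplus>\<^bsub>M\<^esub>b\<in>B. c b \<odot>\<^bsub>M\<^esub> b))"

definition vector_space_of_dim :: "'r ring \<Rightarrow> ('r, 'a) module \<Rightarrow> nat \<Rightarrow> bool" where
  "vector_space_of_dim R M n \<longleftrightarrow>
     Ring.field R \<and> Module.module R M \<and> (\<exists>B. module_basis R M B \<and> card B = n)"

end

theory Submission
  imports Defs "HOL-Complex_Analysis.Complex_Analysis"
begin

text \<open>A point \<open>x + Iy\<close> of the slice of \<open>I\<close> is coordinatised by the complex number \<open>z = x + \<i>y\<close>
(\<^term>\<open>slice_pt I (Re z) (Im z)\<close>), and a slice regular \<open>f\<close> is given in all slices at once by
\<open>f(x + Iy) = F1(z) + I F2(z)\<close>, with the same quaternion-valued pair \<open>(F1, F2)\<close> for every \<open>I\<close>.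
Comparing the slices of \<open>I\<close> and \<open>- I\<close> turns the regularity of \<open>f\<close> into the Cauchy--Riemann
equations for \<open>(F1, F2)\<close> (\<open>SR_stem_derivative\<close>). These equations are linear over the reals, so
for every real-linear \<open>l\<close> on the quaternions the function \<open>l(F1) + \<i> l(F2)\<close> is holomorphic, and it
commutes with conjugation (\<open>cstem_holomorphic\<close>, \<open>cstem_cnj\<close>). Conversely such complex functions are exactly the
slice preserving slice regular functions (\<open>SR_qlift\<close>, \<open>slice_preserving_cstem\<close>).

Now let \<open>l\<^sub>0, \<dots>, l\<^sub>3\<close> be the coordinate functionals of the basis \<open>e = (1, I, J, K)\<close>.
Expanding \<open>F1\<close> and \<open>F2\<close> in this basis gives \<open>f = \<Sum> f\<^sub>k e\<^sub>k\<close>, where \<open>f\<^sub>k\<close> is slice preserving and belongs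
to \<open>l\<^sub>k(F1) + \<i> l\<^sub>k(F2)\<close> (\<open>qcomp_expansion\<close>). The \<open>f\<^sub>k\<close> are recovered from the sum by applying \<open>l\<^sub>k\<close> to
its stem, so they are unique (\<open>cstem_combination\<close>). Taking components commutes with multiplication
by the slice preserving factor \<open>\<Delta>\<^sub>p\<^sup>m\<close>; hence the poles of the components are no worse than those of \<open>f\<close>,
and components of a semi-regular function are semi-regular (\<open>sem_reps_qcomp\<close>).

Two points remain. First, semi-regular functions are classes of functions with different domains.
Each domain omits only isolated spheres, so every point of \<open>\<Omega>\<close> is a limit, inside its slice, of points
of any finite number of domains, and continuity along slices makes identities on a smaller domain
extend (\<open>sem_reps_eq_dense\<close>); all algebraic laws can then be checked pointwise on representatives.
Secondly, the slice preserving classes form a field. Near a sphere, \<open>\<Delta>\<^sub>p\<^sup>m f\<close> is a holomorphic function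
\<open>\<psi>\<close> in the complex coordinate; if \<open>\<psi>\<close> is not identically zero there, its zero has some finite order \<open>n\<close>,
and \<open>\<Delta>\<^sub>p\<^sup>n / \<psi>\<close> extends (\<open>reciprocal_extends\<close>). The spheres near which \<open>f\<close> vanishes identically and those
around which it is zero-free form two open sets covering the connected set \<open>\<Omega>\<close>, so a nonzero class
has the second behaviour everywhere and is invertible (\<open>sem_reps_inverse\<close>).\<close>

section \<open>Complex coordinates on the quaternions\<close>

text \<open>The complex coordinate of a slice. For \<open>I \<in> qunits\<close> this is the embedding of the field of complex
numbers into the quaternions that sends \<open>\<i>\<close> to \<open>I\<close>, so identities inside one slice are identities
between complex numbers.\<close>

definition qemb :: "quat \<Rightarrow> complex \<Rightarrow> quat" where
  "qemb I z = slice_pt I (Re z) (Im z)"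

text \<open>Picks one complex coordinate for a quaternion independently of a slice, namely the one in the closed
upper half plane. Its fibres are the spheres \<open>qsphere p\<close>; a circular set is a union of fibres.\<close>

definition qproj :: "quat \<Rightarrow> complex" where
  "qproj q = Complex (qRe q) (sqrt ((qIm1 q)\<^sup>2 + (qIm2 q)\<^sup>2 + (qIm3 q)\<^sup>2))"

abbreviation qi :: quat where
  "qi \<equiv> Quat 0 1 0 0"

lemma of_real_quat: "of_real x = Quat x 0 0 0"
  by (simp add: of_real_def quat_ops_defs)

text \<open>If \<open>I\<^sup>2 = -1\<close> and the real part of \<open>I\<close> is not zero, then the imaginary part of \<open>I\<^sup>2\<close> forces \<open>I\<close> to be
real, and a real square is not \<open>-1\<close>.\<close>

lemma qunits_iff:
  "I \<in> qunits \<longleftrightarrow> qRe I = 0 \<and> (qIm1 I)\<^sup>2 + (qIm2 I)\<^sup>2 + (qIm3 I)\<^sup>2 = 1"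
proof -
  have "qRe I = 0" if "qRe I * qIm1 I = 0" "qRe I * qIm2 I = 0" "qRe I * qIm3 I = 0"
    "qRe I * qRe I - qIm1 I * qIm1 I - qIm2 I * qIm2 I - qIm3 I * qIm3 I = -1"
  proof (rule ccontr)
    assume "qRe I \<noteq> 0"
    with that have "qRe I * qRe I = -1" by simp
    then show False using zero_le_square[of "qRe I"] by linarith
  qed
  then show ?thesis
    by (auto simp: qunits_def power2_eq_square quat_eq_iff quat_ops_defs)
qed

lemma qi_in_qunits [simp]: "qi \<in> qunits"
  by (simp add: qunits_iff)

lemma uminus_in_qunits [simp]: "- I \<in> qunits \<longleftrightarrow> I \<in> qunits"
  by (simp add: qunits_def)

lemma qunits_square: "I \<in> qunits \<Longrightarrow> I * I = -1"
  by (simp add: qunits_def power2_eq_square)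

lemma qemb_eq: "qemb I z = of_real (Re z) + I * of_real (Im z)"
  by (simp add: qemb_def slice_pt_def)

lemma qemb_Quat:
  "I \<in> qunits \<Longrightarrow> qemb I z = Quat (Re z) (Im z * qIm1 I) (Im z * qIm2 I) (Im z * qIm3 I)"
  by (simp add: qemb_eq of_real_quat quat_ops_defs qunits_iff)

lemma slice_pt_qemb: "slice_pt I x y = qemb I (Complex x y)"
  by (simp add: qemb_def)

lemma slice_conv: "slice I = range (qemb I)"
proof (intro equalityI subsetI)
  fix q assume "q \<in> range (qemb I)"
  then show "q \<in> slice I" unfolding slice_def qemb_def by blast
qed (auto simp: slice_def slice_pt_qemb)

lemma qemb_add: "qemb I (z + w) = qemb I z + qemb I w"
  by (simp add: qemb_eq algebra_simps)

lemma qemb_minus: "qemb I (- z) = - qemb I z"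
  by (simp add: qemb_eq)

lemma qemb_diff: "qemb I (z - w) = qemb I z - qemb I w"
  by (simp add: qemb_eq algebra_simps)

lemma qemb_of_real [simp]: "qemb I (of_real r) = of_real r"
  by (simp add: qemb_eq)

lemma qemb_0 [simp]: "qemb I 0 = 0" and qemb_1 [simp]: "qemb I 1 = 1"
  by (simp_all add: qemb_eq)

lemma qemb_mult:
  assumes "I \<in> qunits"
  shows "qemb I (z * w) = qemb I z * qemb I w"
proof -
  have "qRe I = 0" "(qIm1 I)\<^sup>2 + (qIm2 I)\<^sup>2 + (qIm3 I)\<^sup>2 = 1"
    using assms by (simp_all add: qunits_iff)
  then have "Im z * Im w = ((qIm1 I)\<^sup>2 + (qIm2 I)\<^sup>2 + (qIm3 I)\<^sup>2) * (Im z * Im w)"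
    by simp
  also have "\<dots> = Im z * qIm1 I * (Im w * qIm1 I) + Im z * qIm2 I * (Im w * qIm2 I)
      + Im z * qIm3 I * (Im w * qIm3 I)"
    by (simp add: algebra_simps power2_eq_square)
  finally show ?thesis
    using \<open>qRe I = 0\<close> unfolding qemb_Quat[OF assms] times_quat_def
    by (simp add: quat_eq_iff) (simp add: algebra_simps)
qed

lemma qemb_eq_0_iff [simp]:
  assumes "I \<in> qunits" shows "qemb I z = 0 \<longleftrightarrow> z = 0"
proof
  assume *: "qemb I z = 0"
  show "z = 0"
  proof (rule ccontr)
    assume "z \<noteq> 0"
    then have "1 = qemb I (inverse z * z)" by simp
    also have "\<dots> = 0" using * by (simp only: qemb_mult[OF assms] mult_zero_right)
    finally show False by simp
  qed
qed simp

lemma qemb_inverse: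
  assumes "I \<in> qunits" shows "qemb I (inverse z) = inverse (qemb I z)"
proof (cases "z = 0")
  case False
  then have "qemb I z * qemb I (inverse z) = 1"
    by (simp flip: qemb_mult[OF assms])
  from inverse_unique[OF this] show ?thesis by simp
qed simp

lemma qemb_power: "I \<in> qunits \<Longrightarrow> qemb I (z ^ n) = qemb I z ^ n"
  by (induction n) (simp_all add: qemb_mult)

lemma qemb_uminus_unit: "qemb (- I) z = qemb I (cnj z)"
  by (simp add: qemb_eq)

lemma qproj_qemb: "I \<in> qunits \<Longrightarrow> qproj (qemb I z) = Complex (Re z) \<bar>Im z\<bar>"
proof -
  assume I: "I \<in> qunits"
  have "(Im z * qIm1 I)\<^sup>2 + (Im z * qIm2 I)\<^sup>2 + (Im z * qIm3 I)\<^sup>2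
    = (Im z)\<^sup>2 * ((qIm1 I)\<^sup>2 + (qIm2 I)\<^sup>2 + (qIm3 I)\<^sup>2)"
    by (simp add: power_mult_distrib distrib_left)
  then show ?thesis using I by (simp add: qproj_def qemb_Quat) (simp add: qunits_iff)
qed

lemma qproj_qemb_cases: "I \<in> qunits \<Longrightarrow> qproj (qemb I z) = z \<or> qproj (qemb I z) = cnj z"
  by (auto simp: qproj_qemb complex_eq_iff)

lemma Im_qproj_nonneg: "Im (qproj q) \<ge> 0"
  by (simp add: qproj_def)

text \<open>Divide the imaginary part by its length; for a real quaternion any imaginary unit will do.\<close>

lemma qemb_surj: "\<exists>I\<in>qunits. q = qemb I (qproj q)"
proof (cases "Im (qproj q) = 0")
  case True
  have "q = qemb qi (qproj q)"
    using True by (simp add: qemb_Quat qproj_def quat_eq_iff add_nonneg_eq_0_iff)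
  then show ?thesis by (intro bexI[of _ qi]) auto
next
  case False
  define r where "r = Im (qproj q)"
  have r: "r \<noteq> 0" "r\<^sup>2 = (qIm1 q)\<^sup>2 + (qIm2 q)\<^sup>2 + (qIm3 q)\<^sup>2"
    using False by (simp_all add: r_def qproj_def)
  define I where "I = Quat 0 (qIm1 q / r) (qIm2 q / r) (qIm3 q / r)"
  have "I \<in> qunits"
    using r(1) by (simp add: qunits_iff I_def power_divide flip: add_divide_distrib r(2))
  moreover from this have "q = qemb I (qproj q)"
    using r(1) by (simp add: qemb_Quat quat_eq_iff r_def[symmetric]) (simp add: I_def qproj_def)
  ultimately show ?thesis by blast
qed

lemma qemb_cases:
  obtains I z where "I \<in> qunits" "q = qemb I z" "z = qproj q"
  using qemb_surj by metis

lemma qsphere_conv: "qsphere p = {q. qproj q = qproj p}"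
proof (intro equalityI subsetI CollectI)
  fix q assume "q \<in> qsphere p"
  then show "qproj q = qproj p"
    by (auto simp: qsphere_def slice_pt_qemb qproj_qemb)
next
  fix q assume "q \<in> {q. qproj q = qproj p}"
  then have eq: "qproj q = qproj p" by simp
  obtain I where "I \<in> qunits" "p = qemb I (qproj p)" using qemb_surj by blast
  moreover obtain J where "J \<in> qunits" "q = qemb J (qproj p)" using qemb_surj eq by metis
  ultimately show "q \<in> qsphere p"
    unfolding qsphere_def qemb_def by blast
qed

lemma circular_iff: "circular U \<longleftrightarrow> (\<forall>p q. p \<in> U \<longrightarrow> qproj q = qproj p \<longrightarrow> q \<in> U)"
  by (auto simp: circular_def qsphere_conv)

lemma circular_qproj_vimage: "circular (qproj -` W)"
  by (simp add: circular_iff)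

lemma circular_Int: "circular U \<Longrightarrow> circular V \<Longrightarrow> circular (U \<inter> V)"
  unfolding circular_iff by blast

lemma circular_Diff_sphere: "circular U \<Longrightarrow> circular (U - qsphere p)"
  by (auto simp: circular_iff qsphere_conv)

text \<open>The trace of a set in the slice of \<open>qi\<close>, in the complex coordinate. For a circular set all slices
have the same trace.\<close>

definition cdom :: "quat set \<Rightarrow> complex set" where
  "cdom U = {z. qemb qi z \<in> U}"

lemma qemb_mem_iff: "circular U \<Longrightarrow> I \<in> qunits \<Longrightarrow> qemb I z \<in> U \<longleftrightarrow> z \<in> cdom U"
  unfolding circular_iff cdom_def by (metis mem_Collect_eq qi_in_qunits qproj_qemb)

lemma qproj_mem_iff: "circular U \<Longrightarrow> qproj q \<in> cdom U \<longleftrightarrow> q \<in> U"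
  by (metis qemb_mem_iff qemb_surj)

lemma cnj_mem_cdom: "circular U \<Longrightarrow> cnj z \<in> cdom U \<longleftrightarrow> z \<in> cdom U"
  by (metis qemb_mem_iff qemb_uminus_unit qi_in_qunits uminus_in_qunits)

lemma cdom_mono: "U \<subseteq> V \<Longrightarrow> cdom U \<subseteq> cdom V"
  by (auto simp: cdom_def)

lemma qemb_bounded_linear: "bounded_linear (qemb I)"
  unfolding qemb_eq[abs_def]
  by (intro bounded_linear_add bounded_linear_const_mult
      bounded_linear_compose[OF bounded_linear_of_real] bounded_linear_Re bounded_linear_Im)

lemma bounded_linear_quat_components:
  "bounded_linear qRe" "bounded_linear qIm1" "bounded_linear qIm2" "bounded_linear qIm3"
proof -
  have "qRe = (\<lambda>q. q \<bullet> Quat 1 0 0 0)" "qIm1 = (\<lambda>q. q \<bullet> Quat 0 1 0 0)"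
    "qIm2 = (\<lambda>q. q \<bullet> Quat 0 0 1 0)" "qIm3 = (\<lambda>q. q \<bullet> Quat 0 0 0 1)"
    by (simp_all add: inner_quat_def)
  then show "bounded_linear qRe" "bounded_linear qIm1" "bounded_linear qIm2" "bounded_linear qIm3"
    by (metis bounded_linear_inner_left)+
qed

lemma continuous_on_qproj: "continuous_on UNIV qproj"
  unfolding qproj_def[abs_def]
  by (intro continuous_intros
      bounded_linear_quat_components[THEN bounded_linear.continuous_on])

lemma open_qproj_vimage: "open W \<Longrightarrow> open (qproj -` W)"
  using continuous_on_qproj by (simp add: continuous_on_open_vimage)

lemma open_cdom: "open U \<Longrightarrow> open (cdom U)"
proof -
  assume "open U"
  moreover have "continuous_on UNIV (qemb qi)"
    by (intro linear_continuous_on qemb_bounded_linear)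
  ultimately have "open (qemb qi -` U)"
    by (simp add: continuous_on_open_vimage)
  then show ?thesis by (simp add: cdom_def vimage_def)
qed

lemma qemb_mem_qsphere_iff:
  "I \<in> qunits \<Longrightarrow> qemb I w \<in> qsphere p \<longleftrightarrow> w = qproj p \<or> w = cnj (qproj p)"
  using Im_qproj_nonneg[of p] by (auto simp: qsphere_conv qproj_qemb complex_eq_iff)

text \<open>The roots of \<open>\<Delta>\<^sub>p\<close> in a slice are the two points of the sphere of \<open>p\<close> in that slice.\<close>

lemma qDelta_qemb:
  assumes "I \<in> qunits"
  shows "qDelta p (qemb I w) = qemb I ((w - qproj p) * (w - cnj (qproj p)))"
proof -
  obtain J where J: "J \<in> qunits" "p = qemb J (qproj p)" using qemb_surj by blast
  have "(norm p)\<^sup>2 = Re (qproj p) * Re (qproj p) + Im (qproj p) * Im (qproj p)"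
  proof -
    have "(norm p)\<^sup>2 = p \<bullet> p" by (simp add: norm_quat_def inner_quat_def)
    then show ?thesis by (simp add: inner_quat_def qproj_def power2_eq_square
        flip: real_sqrt_mult) 
  qed
  moreover have "qRe p = Re (qproj p)" by (simp add: qproj_def)
  ultimately have "qDelta p (qemb I w) = qemb I (w * w - of_real (2 * Re (qproj p)) * w
      + of_real (Re (qproj p) * Re (qproj p) + Im (qproj p) * Im (qproj p)))"
    by (simp only: qDelta_def qemb_add qemb_diff qemb_mult[OF assms] qemb_of_real power2_eq_square)
  also have "w * w - of_real (2 * Re (qproj p)) * w
      + of_real (Re (qproj p) * Re (qproj p) + Im (qproj p) * Im (qproj p))
      = (w - qproj p) * (w - cnj (qproj p))"
    by (simp add: complex_eq_iff algebra_simps)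
  finally show ?thesis .
qed

text \<open>The slice of \<open>I\<close> is the centraliser of \<open>I\<close>: two vectors of three-space with vanishing cross product
are parallel. As a closed condition this lets slice preservation pass to limits.\<close>

lemma mem_slice_iff:
  assumes "I \<in> qunits"
  shows "q \<in> slice I \<longleftrightarrow> I * q = q * I"
proof
  assume "q \<in> slice I"
  then show "I * q = q * I"
    by (auto simp: slice_conv qemb_eq algebra_simps of_real_def)
next
  assume *: "I * q = q * I"
  have u: "qRe I = 0" "(qIm1 I)\<^sup>2 + (qIm2 I)\<^sup>2 + (qIm3 I)\<^sup>2 = 1"
    using assms by (simp_all add: qunits_iff)
  have c: "qIm2 I * qIm3 q = qIm3 I * qIm2 q" "qIm3 I * qIm1 q = qIm1 I * qIm3 q"
    "qIm1 I * qIm2 q = qIm2 I * qIm1 q"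
    using * by (simp_all add: quat_eq_iff times_quat_def u(1) mult.commute)
  define t where "t = qIm1 I * qIm1 q + qIm2 I * qIm2 q + qIm3 I * qIm3 q"
  \<comment> \<open>The triple product identity for the imaginary parts; the brackets are the components of
    their cross product, which vanishes, and \<open>s = 1\<close>.\<close>
  define s where "s = (qIm1 I)\<^sup>2 + (qIm2 I)\<^sup>2 + (qIm3 I)\<^sup>2"
  have "t * qIm1 I = s * qIm1 q + qIm2 I * (qIm1 I * qIm2 q - qIm2 I * qIm1 q)
      - qIm3 I * (qIm3 I * qIm1 q - qIm1 I * qIm3 q)"
    "t * qIm2 I = s * qIm2 q + qIm3 I * (qIm2 I * qIm3 q - qIm3 I * qIm2 q)
      - qIm1 I * (qIm1 I * qIm2 q - qIm2 I * qIm1 q)"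
    "t * qIm3 I = s * qIm3 q + qIm1 I * (qIm3 I * qIm1 q - qIm1 I * qIm3 q)
      - qIm2 I * (qIm2 I * qIm3 q - qIm3 I * qIm2 q)"
    by (simp_all add: t_def s_def algebra_simps power2_eq_square)
  then have "t * qIm1 I = qIm1 q" "t * qIm2 I = qIm2 q" "t * qIm3 I = qIm3 q"
    by (simp_all add: c s_def u(2))
  then have "q = qemb I (Complex (qRe q) t)"
    using assms by (simp add: qemb_Quat quat_eq_iff)
  then show "q \<in> slice I" by (auto simp: slice_conv)
qed

lemma slice_commute:
  assumes "I \<in> qunits" "p \<in> slice I" "q \<in> slice I" shows "p * q = q * p"
  using assms by (auto simp: slice_conv mult.commute simp flip: qemb_mult)

lemma slice_mult:
  assumes "I \<in> qunits" "p \<in> slice I" "q \<in> slice I" shows "p * q \<in> slice I"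
  using assms by (auto simp: slice_conv simp flip: qemb_mult)

lemma slice_add: "p \<in> slice I \<Longrightarrow> q \<in> slice I \<Longrightarrow> p + q \<in> slice I"
  by (auto simp: slice_conv simp flip: qemb_add)

lemma qemb_mem_slice [simp]: "qemb I z \<in> slice I"
  by (auto simp: slice_conv)

lemma slice_preserving_iff:
  "slice_preserving f U \<longleftrightarrow> (\<forall>I\<in>qunits. \<forall>z. qemb I z \<in> U \<longrightarrow> f (qemb I z) \<in> slice I)"
  unfolding slice_preserving_def slice_conv by blast

section \<open>Slice regular functions\<close>

text \<open>Slice regularity rewritten in the complex coordinate: the two real partial derivatives are the values
of the derivative at \<open>1\<close> and at \<open>\<i>\<close>.\<close>

lemma SR_iff:
  "f \<in> SR U \<longleftrightarrow> open U \<and> circular U \<and>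
     (\<exists>F1 F2 :: complex \<Rightarrow> quat. (\<forall>z. F1 (cnj z) = F1 z \<and> F2 (cnj z) = - F2 z) \<and>
        (\<forall>I\<in>qunits. \<forall>z. qemb I z \<in> U \<longrightarrow> f (qemb I z) = F1 z + I * F2 z)) \<and>
     (\<forall>I\<in>qunits. \<forall>z. qemb I z \<in> U \<longrightarrow>
        (\<exists>f'. ((\<lambda>w. f (qemb I w)) has_derivative f') (at z) \<and> f' 1 + I * f' \<i> = 0))"
proof -
  have stem: "(\<exists>F1 F2 :: real \<Rightarrow> real \<Rightarrow> quat.
        (\<forall>x y. F1 x (- y) = F1 x y \<and> F2 x (- y) = - F2 x y) \<and>
        (\<forall>I\<in>qunits. \<forall>x y. slice_pt I x y \<in> U \<longrightarrow>
           f (slice_pt I x y) = F1 x y + I * F2 x y)) \<longleftrightarrow>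
     (\<exists>F1 F2 :: complex \<Rightarrow> quat. (\<forall>z. F1 (cnj z) = F1 z \<and> F2 (cnj z) = - F2 z) \<and>
        (\<forall>I\<in>qunits. \<forall>z. qemb I z \<in> U \<longrightarrow> f (qemb I z) = F1 z + I * F2 z))"
    (is "?L \<longleftrightarrow> ?R")
  proof
    assume ?L
    then obtain F1 F2 :: "real \<Rightarrow> real \<Rightarrow> quat" where
      "\<forall>x y. F1 x (- y) = F1 x y \<and> F2 x (- y) = - F2 x y"
      "\<forall>I\<in>qunits. \<forall>x y. slice_pt I x y \<in> U \<longrightarrow> f (slice_pt I x y) = F1 x y + I * F2 x y"
      by blast
    then show ?R
      by (intro exI[of _ "\<lambda>z. F1 (Re z) (Im z)"] exI[of _ "\<lambda>z. F2 (Re z) (Im z)"])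
        (simp add: qemb_def)
  next
    assume ?R
    then obtain F1 F2 :: "complex \<Rightarrow> quat" where
      F: "\<And>z. F1 (cnj z) = F1 z" "\<And>z. F2 (cnj z) = - F2 z"
      "\<And>I z. I \<in> qunits \<Longrightarrow> qemb I z \<in> U \<Longrightarrow> f (qemb I z) = F1 z + I * F2 z"
      by blast
    have "F1 (Complex x (-y)) = F1 (Complex x y)" "F2 (Complex x (-y)) = - F2 (Complex x y)" for x y
      using F(1)[of "Complex x y"] F(2)[of "Complex x y"] by (simp_all add: complex_cnj)
    with F(3) show ?L
      by (intro exI[of _ "\<lambda>x y. F1 (Complex x y)"] exI[of _ "\<lambda>x y. F2 (Complex x y)"])
        (simp add: slice_pt_qemb)
  qed
  have deriv: "(\<exists>f'. ((\<lambda>(s, t). f (slice_pt I s t)) has_derivative f') (at (Re z, Im z)) \<and>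
      (1 / 2) *\<^sub>R (f' (1, 0) + I * f' (0, 1)) = 0) \<longleftrightarrow>
    (\<exists>f'. ((\<lambda>w. f (qemb I w)) has_derivative f') (at z) \<and> f' 1 + I * f' \<i> = 0)"
    (is "?L \<longleftrightarrow> ?R") for I z
  proof
    assume ?L
    then obtain f' where f': "((\<lambda>(s, t). f (slice_pt I s t)) has_derivative f') (at (Re z, Im z))"
      "f' (1, 0) + I * f' (0, 1) = 0" by auto
    have "((\<lambda>w. (Re w, Im w)) has_derivative (\<lambda>w. (Re w, Im w))) (at z)"
      by (intro derivative_intros)
    from has_derivative_compose[OF this f'(1)]
    have "((\<lambda>w. f (qemb I w)) has_derivative (\<lambda>w. f' (Re w, Im w))) (at z)"
      by (simp add: qemb_def)
    with f'(2) show ?R by (intro exI[of _ "\<lambda>w. f' (Re w, Im w)"]) simp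
  next
    assume ?R
    then obtain f' where f': "((\<lambda>w. f (qemb I w)) has_derivative f') (at z)"
      "f' 1 + I * f' \<i> = 0" by auto
    have lin: "bounded_linear (\<lambda>p. Complex (fst p) (snd p))"
      unfolding Complex_eq by (intro bounded_linear_add bounded_linear_const_mult
          bounded_linear_compose[OF bounded_linear_of_real] bounded_linear_fst bounded_linear_snd)
    have "((\<lambda>p. Complex (fst p) (snd p)) has_derivative (\<lambda>p. Complex (fst p) (snd p))) (at (Re z, Im z))"
      by (rule bounded_linear_imp_has_derivative[OF lin])
    from has_derivative_compose[OF this, of "\<lambda>w. f (qemb I w)" f'] f'(1)
    have "((\<lambda>(s, t). f (slice_pt I s t)) has_derivative (\<lambda>p. f' (Complex (fst p) (snd p)))) (at (Re z, Im z))"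
      by (simp add: slice_pt_qemb case_prod_unfold)
    moreover have "Complex 1 0 = 1" "Complex 0 1 = \<i>"
      by (simp_all add: complex_eq_iff)
    ultimately show ?L
      using f'(2) by (intro exI[of _ "\<lambda>p. f' (Complex (fst p) (snd p))"]) simp
  qed
  have all: "(\<forall>x y. P x y) \<longleftrightarrow> (\<forall>z. P (Re z) (Im z))" for P :: "real \<Rightarrow> real \<Rightarrow> bool"
    by (metis complex.sel)
  show ?thesis
    unfolding SR_def mem_Collect_eq stem
    unfolding all[of "\<lambda>x y. slice_pt I x y \<in> U \<longrightarrow>
        (\<exists>f'. ((\<lambda>(s, t). f (slice_pt I s t)) has_derivative f') (at (x, y)) \<and>
              (1 / 2) *\<^sub>R (f' (1, 0) + I * f' (0, 1)) = 0)" for I] deriv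
    by (simp add: qemb_def)
qed

lemma SR_open: "f \<in> SR U \<Longrightarrow> open U" and SR_circular: "f \<in> SR U \<Longrightarrow> circular U"
  by (simp_all add: SR_def)

text \<open>The stem of \<open>f\<close>, recovered from the values of \<open>f\<close> in the slice of \<open>qi\<close> alone: the even part here, the
odd part next. Since these formulas make sense for every \<open>f\<close>, the stem need not be chosen from an
existential statement, and its parity in \<open>Im z\<close> holds at all points.\<close>

definition stem1 :: "(quat \<Rightarrow> quat) \<Rightarrow> complex \<Rightarrow> quat" where
  "stem1 f z = (f (qemb qi z) + f (qemb qi (cnj z))) /\<^sub>R 2"

definition stem2 :: "(quat \<Rightarrow> quat) \<Rightarrow> complex \<Rightarrow> quat" where
  "stem2 f z = - qi * (f (qemb qi z) - f (qemb qi (cnj z))) /\<^sub>R 2"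

lemma stem1_cnj [simp]: "stem1 f (cnj z) = stem1 f z"
  by (simp add: stem1_def add.commute)

lemma stem2_cnj [simp]: "stem2 f (cnj z) = - stem2 f z"
  by (simp add: stem2_def algebra_simps)

text \<open>Evaluate at \<open>z\<close> and \<open>cnj z\<close> in the slice of \<open>qi\<close>: half the sum is \<open>F1 z\<close>, half the difference is
\<open>qi * F2 z\<close>.\<close>

lemma stem_unique:
  assumes U: "circular U" and z: "z \<in> cdom U"
    and F: "\<And>I w. I \<in> qunits \<Longrightarrow> qemb I w \<in> U \<Longrightarrow> f (qemb I w) = F1 w + I * F2 w"
    and sym: "F1 (cnj z) = F1 z" "F2 (cnj z) = - F2 z"
  shows "stem1 f z = F1 z" "stem2 f z = F2 z"
proof -
  have *: "f (qemb qi z) = F1 z + qi * F2 z" "f (qemb qi (cnj z)) = F1 z - qi * F2 z"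
    using F[of qi z] F[of qi "cnj z"] sym U z by (simp_all add: qemb_mem_iff cnj_mem_cdom)
  have "F2 z = - qi * (qi * F2 z)"
    using qunits_square[OF qi_in_qunits] by (simp flip: mult.assoc)
  then show "stem1 f z = F1 z" "stem2 f z = F2 z"
    unfolding stem1_def stem2_def * by (simp_all flip: scaleR_2 add: algebra_simps)
qed

lemma SR_stem:
  assumes "f \<in> SR U" "I \<in> qunits" "z \<in> cdom U"
  shows "f (qemb I z) = stem1 f z + I * stem2 f z"
proof -
  obtain F1 F2 where F: "\<And>z. F1 (cnj z) = F1 z" "\<And>z. F2 (cnj z) = - F2 z"
      "\<And>I z. I \<in> qunits \<Longrightarrow> qemb I z \<in> U \<Longrightarrow> f (qemb I z) = F1 z + I * F2 z"
    using assms(1) unfolding SR_iff by blast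
  have U: "circular U" using assms(1) by (rule SR_circular)
  show ?thesis
    using F(3)[of I z] stem_unique[OF U assms(3), of f F1 F2] F assms(2,3) U
    by (simp add: qemb_mem_iff)
qed

text \<open>The Cauchy--Riemann equations for the stem. Regularity in the slices of \<open>qi\<close> and of \<open>- qi\<close> gives two
quaternionic equations, whose sum and difference separate \<open>F1\<close> from \<open>F2\<close>.\<close>

lemma SR_stem_derivative:
  assumes f: "f \<in> SR U" and z: "z \<in> cdom U"
  obtains D1 D2 where "(stem1 f has_derivative D1) (at z)" "(stem2 f has_derivative D2) (at z)"
    "D1 1 = D2 \<i>" "D2 1 = - D1 \<i>"
proof -
  have U: "circular U" using f by (rule SR_circular)
  have "\<exists>f'. ((\<lambda>w. f (qemb I w)) has_derivative f') (at z) \<and> f' 1 + I * f' \<i> = 0"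
    if "I \<in> qunits" for I
    using f z that U unfolding SR_iff by (simp add: qemb_mem_iff)
  from this[of qi] this[of "- qi"] obtain a b where
    a: "((\<lambda>w. f (qemb qi w)) has_derivative a) (at z)" "a 1 + qi * a \<i> = 0" and
    b: "((\<lambda>w. f (qemb qi (cnj w))) has_derivative b) (at z)" "b 1 + - qi * b \<i> = 0"
    by (auto simp: qemb_uminus_unit)
  define D1 where "D1 = (\<lambda>h. (a h + b h) /\<^sub>R 2)"
  define D2 where "D2 = (\<lambda>h. - qi * (a h - b h) /\<^sub>R 2)"
  have d: "(stem1 f has_derivative D1) (at z)" "(stem2 f has_derivative D2) (at z)"
    unfolding D1_def D2_def stem1_def[abs_def] stem2_def[abs_def]
    by (intro derivative_intros has_derivative_scaleR_right has_derivative_mult_right a b)+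
  have ab: "a 1 = - qi * a \<i>" "b 1 = qi * b \<i>"
    using a(2) b(2) by (simp_all add: add_eq_0_iff)
  have q: "qi * (qi * x) = - x" for x
    using qunits_square[OF qi_in_qunits] by (simp flip: mult.assoc)
  have "D1 1 = D2 \<i>" "D2 1 = - D1 \<i>"
    by (simp_all add: D1_def D2_def ab algebra_simps q)
  with d show thesis by (rule that)
qed

lemma SR_cong:
  assumes f: "f \<in> SR U" and V: "open V" "circular V" "V \<subseteq> U" and eq: "\<And>q. q \<in> V \<Longrightarrow> g q = f q"
  shows "g \<in> SR V"
  unfolding SR_iff
proof (intro conjI V ballI allI impI)
  show "\<exists>F1 F2. (\<forall>z. F1 (cnj z) = F1 z \<and> F2 (cnj z) = - F2 z) \<and>
    (\<forall>I\<in>qunits. \<forall>z. qemb I z \<in> V \<longrightarrow> g (qemb I z) = F1 z + I * F2 z)"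
    using SR_stem[OF f] eq V SR_circular[OF f]
    by (intro exI[of _ "stem1 f"] exI[of _ "stem2 f"]) (auto simp: qemb_mem_iff dest!: cdom_mono)
  fix I z assume I: "I \<in> qunits" and "qemb I z \<in> V"
  then have z: "z \<in> cdom V" "qemb I z \<in> U" using V by (auto simp: qemb_mem_iff)
  then obtain f' where f': "((\<lambda>w. f (qemb I w)) has_derivative f') (at z)" "f' 1 + I * f' \<i> = 0"
    using f I unfolding SR_iff by blast
  have "((\<lambda>w. g (qemb I w)) has_derivative f') (at z)"
    by (rule has_derivative_transform_within_open[OF f'(1) open_cdom[OF V(1)] z(1)])
      (use eq V(2) I in \<open>simp add: qemb_mem_iff\<close>)
  with f'(2) show "\<exists>f'. ((\<lambda>w. g (qemb I w)) has_derivative f') (at z) \<and> f' 1 + I * f' \<i> = 0"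
    by blast
qed

lemma SR_subset: "f \<in> SR U \<Longrightarrow> open V \<Longrightarrow> circular V \<Longrightarrow> V \<subseteq> U \<Longrightarrow> f \<in> SR V"
  by (rule SR_cong) auto

lemma SR_add:
  assumes f: "f \<in> SR U" and g: "g \<in> SR U"
  shows "(\<lambda>q. f q + g q) \<in> SR U"
  unfolding SR_iff
proof (intro conjI ballI allI impI)
  show U: "open U" "circular U" using f by (simp_all add: SR_open SR_circular)
  show "\<exists>F1 F2. (\<forall>z. F1 (cnj z) = F1 z \<and> F2 (cnj z) = - F2 z) \<and>
    (\<forall>I\<in>qunits. \<forall>z. qemb I z \<in> U \<longrightarrow> f (qemb I z) + g (qemb I z) = F1 z + I * F2 z)"
    using SR_stem[OF f] SR_stem[OF g] U(2)
    by (intro exI[of _ "\<lambda>z. stem1 f z + stem1 g z"] exI[of _ "\<lambda>z. stem2 f z + stem2 g z"])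
      (simp add: qemb_mem_iff algebra_simps)
  fix I z assume I: "I \<in> qunits" and "qemb I z \<in> U"
  then obtain f' g' where
    "((\<lambda>w. f (qemb I w)) has_derivative f') (at z)" "f' 1 + I * f' \<i> = 0"
    "((\<lambda>w. g (qemb I w)) has_derivative g') (at z)" "g' 1 + I * g' \<i> = 0"
    using f g unfolding SR_iff by meson
  then show "\<exists>f'. ((\<lambda>w. f (qemb I w) + g (qemb I w)) has_derivative f') (at z) \<and> f' 1 + I * f' \<i> = 0"
    by (intro exI[of _ "\<lambda>h. f' h + g' h"])
      (auto intro!: has_derivative_add simp: algebra_simps add_eq_0_iff)
qed

lemma SR_const: "open U \<Longrightarrow> circular U \<Longrightarrow> (\<lambda>_. c) \<in> SR U"
  unfolding SR_iff
  by (intro conjI ballI allI impI exI[of _ "\<lambda>_. 0"]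
      exI[of _ "\<lambda>_. c"] exI[of "\<lambda>F2. _ F2 \<and> _ F2" "\<lambda>_. 0"]) auto

text \<open>For every unit \<open>I\<close> the values at \<open>z\<close> and \<open>cnj z\<close> lie in the slice of \<open>I\<close>, hence so do \<open>F1 z\<close> and \<open>F2 z\<close>. As
these two do not depend on \<open>I\<close>, they lie in the intersection of all slices, the real axis.\<close>

lemma slice_preserving_stem_real:
  assumes f: "f \<in> SR U" "slice_preserving f U" and z: "z \<in> cdom U"
  shows "stem1 f z \<in> \<real>" "stem2 f z \<in> \<real>"
proof -
  have U: "circular U" using f(1) by (rule SR_circular)
  have *: "stem1 f z \<in> slice I \<and> stem2 f z \<in> slice I" if I: "I \<in> qunits" for I
  proof -
    have II: "I * (I * x) = - x" for x
      using qunits_square[OF I] by (simp flip: mult.assoc)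
    have c: "f (qemb I z) = stem1 f z + I * stem2 f z"
      "f (qemb I (cnj z)) = stem1 f z - I * stem2 f z"
      using SR_stem[OF f(1) I, of z] SR_stem[OF f(1) I, of "cnj z"] U z
      by (simp_all add: cnj_mem_cdom)
    have "f (qemb I z) \<in> slice I" "f (qemb I (cnj z)) \<in> slice I"
      using f(2) I z U unfolding slice_preserving_iff by (simp_all add: qemb_mem_iff cnj_mem_cdom)
    then have e: "I * (stem1 f z + I * stem2 f z) = (stem1 f z + I * stem2 f z) * I"
      "I * (stem1 f z - I * stem2 f z) = (stem1 f z - I * stem2 f z) * I"
      unfolding mem_slice_iff[OF I] c by simp_all
    have "2 *\<^sub>R (I * stem1 f z) = 2 *\<^sub>R (stem1 f z * I)"
      using arg_cong2[OF e, of "(+)"] by (simp add: algebra_simps scaleR_2)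
    moreover have "2 *\<^sub>R (- stem2 f z) = 2 *\<^sub>R (I * stem2 f z * I)"
      using arg_cong2[OF e, of "(-)"] by (simp add: algebra_simps scaleR_2 II) (simp add: add_eq_0_iff)
    then have "- stem2 f z = I * stem2 f z * I" unfolding scaleR_cancel_left by simp
    then have "I * (- stem2 f z) = I * (I * stem2 f z * I)" by (rule arg_cong)
    ultimately show ?thesis
      unfolding mem_slice_iff[OF I] by (simp add: mult.assoc II)
  qed
  have real: "x \<in> \<real>" if "\<And>I. I \<in> qunits \<Longrightarrow> x \<in> slice I" for x
  proof -
    have "Quat 0 1 0 0 \<in> qunits" "Quat 0 0 1 0 \<in> qunits" by (simp_all add: qunits_iff)
    with that have "Quat 0 1 0 0 * x = x * Quat 0 1 0 0" "Quat 0 0 1 0 * x = x * Quat 0 0 1 0"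
      using mem_slice_iff by blast+
    then have "x = of_real (qRe x)"
      by (simp add: quat_eq_iff times_quat_def of_real_quat)
    then show ?thesis by (metis Reals_of_real)
  qed
  show "stem1 f z \<in> \<real>" "stem2 f z \<in> \<real>" using * real by blast+
qed

text \<open>The stem of \<open>f\<close> seen through a real functional \<open>l\<close>. For slice preserving \<open>f\<close> and \<open>l = qRe\<close> this is \<open>f\<close> itself
in the complex coordinate.\<close>

definition cstem :: "(quat \<Rightarrow> real) \<Rightarrow> (quat \<Rightarrow> quat) \<Rightarrow> complex \<Rightarrow> complex" where
  "cstem l f z = Complex (l (stem1 f z)) (l (stem2 f z))"

lemma cstem_cnj: "linear l \<Longrightarrow> cstem l f (cnj z) = cnj (cstem l f z)"
  by (simp add: cstem_def complex_eq_iff linear_neg)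

text \<open>A real-linear functional commutes with real differentiation, so it carries the Cauchy--Riemann
equations of the stem to those of \<open>cstem l f\<close>.\<close>

lemma cstem_holomorphic:
  assumes f: "f \<in> SR U" and l: "bounded_linear l"
  shows "cstem l f holomorphic_on cdom U"
proof (rule holomorphic_onI)
  fix z assume "z \<in> cdom U"
  then obtain D1 D2 where D: "(stem1 f has_derivative D1) (at z)"
    "(stem2 f has_derivative D2) (at z)" "D1 1 = D2 \<i>" "D2 1 = - D1 \<i>"
    using SR_stem_derivative[OF f] by metis
  note l1 = bounded_linear.has_derivative[OF l D(1)] and l2 = bounded_linear.has_derivative[OF l D(2)]
  have d: "(cstem l f has_derivative (\<lambda>h. of_real (l (D1 h)) + \<i> * of_real (l (D2 h)))) (at z)"
    unfolding cstem_def[abs_def] Complex_eq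
    by (intro has_derivative_add has_derivative_mult_right has_derivative_of_real l1 l2)
  have lin: "linear D1" "linear D2" "linear l"
    using D(1,2) l by (auto dest: has_derivative_linear bounded_linear.linear)
  have "of_real (l (D1 h)) + \<i> * of_real (l (D2 h)) = Complex (l (D1 1)) (l (D2 1)) * h" for h
  proof -
    have h: "h = Re h *\<^sub>R 1 + Im h *\<^sub>R \<i>" by (simp add: complex_eq_iff)
    have "D1 h = Re h *\<^sub>R D1 1 + Im h *\<^sub>R D1 \<i>" "D2 h = Re h *\<^sub>R D2 1 + Im h *\<^sub>R D2 \<i>"
      using lin by (subst h, simp only: linear_add linear_scale)+
    moreover have "D1 \<i> = - D2 1" "D2 \<i> = D1 1" using D by simp_all
    ultimately have "l (D1 h) = Re h * l (D1 1) - Im h * l (D2 1)"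
      "l (D2 h) = Re h * l (D2 1) + Im h * l (D1 1)"
      using lin(3) by (simp_all add: linear_add linear_diff linear_neg linear_scale)
    then show ?thesis by (simp add: complex_eq_iff algebra_simps)
  qed
  with d have "(cstem l f has_field_derivative Complex (l (D1 1)) (l (D2 1))) (at z)"
    unfolding has_field_derivative_def by (simp add: fun_eq_iff[symmetric])
  then show "cstem l f field_differentiable at z within cdom U"
    using field_differentiable_at_within field_differentiable_def by blast
qed

text \<open>The stem is real here, so taking real parts loses nothing: in every slice a slice preserving regular
function is one and the same holomorphic function of the complex coordinate.\<close>

lemma slice_preserving_cstem:
  assumes f: "f \<in> SR U" "slice_preserving f U" and I: "I \<in> qunits" and z: "z \<in> cdom U"
  shows "f (qemb I z) = qemb I (cstem qRe f z)"
proof -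
  have "of_real (qRe x) = x" if "x \<in> \<real>" for x
    using that by (auto simp: Reals_def of_real_quat)
  then show ?thesis
    using SR_stem[OF f(1) I z] slice_preserving_stem_real[OF f z]
    by (simp add: qemb_eq cstem_def)
qed

text \<open>The quaternionic function that equals \<open>\<phi>\<close> in the complex coordinate of every slice. The unit chosen here
is unique unless the argument is real; there \<open>\<phi>\<close> takes real values as soon as it commutes with
conjugation, and the choice does not matter.\<close>

definition qlift :: "(complex \<Rightarrow> complex) \<Rightarrow> quat \<Rightarrow> quat" where
  "qlift \<phi> q = qemb (SOME I. I \<in> qunits \<and> q = qemb I (qproj q)) (\<phi> (qproj q))"

lemma qlift_qemb:
  assumes I: "I \<in> qunits" and sym: "\<phi> (cnj z) = cnj (\<phi> z)"
  shows "qlift \<phi> (qemb I z) = qemb I (\<phi> z)"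
proof -
  define q where "q = qemb I z"
  define J where "J = (SOME J. J \<in> qunits \<and> q = qemb J (qproj q))"
  have J: "J \<in> qunits" "q = qemb J (qproj q)"
    using someI_ex[of "\<lambda>J. J \<in> qunits \<and> q = qemb J (qproj q)"] qemb_surj
    unfolding J_def by blast+
  have "\<exists>K\<in>qunits. q = qemb K (qproj q) \<and> qemb K (\<phi> (qproj q)) = qemb I (\<phi> z)"
  proof (cases "qproj q = z")
    case True then show ?thesis using I by (auto simp: q_def)
  next
    case False
    then have "qproj q = cnj z" using qproj_qemb_cases[OF I] by (auto simp: q_def)
    then show ?thesis
      using I sym by (intro bexI[of _ "-I"]) (auto simp: q_def qemb_uminus_unit)
  qed
  then obtain K where K: "K \<in> qunits" "q = qemb K (qproj q)"
    "qemb K (\<phi> (qproj q)) = qemb I (\<phi> z)" by blast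
  show ?thesis
  proof (cases "Im (qproj q) = 0")
    case True
    then have "cnj (qproj q) = qproj q" "qproj q = z"
      using qproj_qemb_cases[OF I, of z] by (auto simp: q_def complex_eq_iff)
    with sym have "\<phi> (qproj q) = cnj (\<phi> (qproj q))" by simp
    then have "Im (\<phi> (qproj q)) = 0" by (metis Reals_cnj_iff complex_is_Real_iff)
    then show ?thesis
      using K(3) unfolding qlift_def q_def[symmetric] J_def[symmetric] by (simp add: qemb_eq)
  next
    case False
    have "J * of_real (Im (qproj q)) = K * of_real (Im (qproj q))"
      using J(2) K(2) unfolding qemb_eq by (metis add_left_cancel)
    with False have "J = K" by simp
    then show ?thesis
      using K(3) unfolding qlift_def q_def[symmetric] J_def[symmetric] by simp
  qed
qed

text \<open>Converse of \<open>slice_preserving_cstem\<close>: \<open>Re \<phi>\<close> and \<open>Im \<phi>\<close> form a real stem, and complex linearity of the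
derivative of \<open>\<phi>\<close> is regularity in each slice.\<close>

lemma SR_qlift:
  assumes U: "open U" "circular U" and hol: "\<phi> holomorphic_on cdom U"
    and sym: "\<And>z. z \<in> cdom U \<Longrightarrow> \<phi> (cnj z) = cnj (\<phi> z)"
  shows "qlift \<phi> \<in> SR U" "slice_preserving (qlift \<phi>) U"
proof -
  have lift: "qlift \<phi> (qemb I z) = qemb I (\<phi> z)" if "I \<in> qunits" "z \<in> cdom U" for I z
    using qlift_qemb that sym by blast
  show "slice_preserving (qlift \<phi>) U"
    using lift U by (simp add: slice_preserving_iff qemb_mem_iff)
  show "qlift \<phi> \<in> SR U"
    unfolding SR_iff
  proof (intro conjI ballI allI impI U)
    \<comment> \<open>The parity of the stem is demanded at all points, also outside the domain.\<close>
    define \<psi> where "\<psi> z = (if z \<in> cdom U then \<phi> z else 0)" for z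
    have \<psi>: "\<psi> (cnj z) = cnj (\<psi> z)" for z
      using sym by (simp add: \<psi>_def cnj_mem_cdom U)
    have lift': "qlift \<phi> (qemb I z) = of_real (Re (\<psi> z)) + I * of_real (Im (\<psi> z))"
      if "I \<in> qunits" "z \<in> cdom U" for I z
      using lift[OF that] that by (simp add: \<psi>_def qemb_eq[of I "\<phi> z"])
    show "\<exists>F1 F2. (\<forall>z. F1 (cnj z) = F1 z \<and> F2 (cnj z) = - F2 z) \<and>
      (\<forall>I\<in>qunits. \<forall>z. qemb I z \<in> U \<longrightarrow> qlift \<phi> (qemb I z) = F1 z + I * F2 z)"
      by (rule exI[of _ "\<lambda>z. of_real (Re (\<psi> z))"], rule exI[of _ "\<lambda>z. of_real (Im (\<psi> z))"])
        (simp add: \<psi> lift' qemb_mem_iff U)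
    fix I z assume I: "I \<in> qunits" and "qemb I z \<in> U"
    then have z: "z \<in> cdom U" by (simp add: qemb_mem_iff U)
    then obtain D where D: "(\<phi> has_field_derivative D) (at z)"
      using hol open_cdom[OF U(1)] by (metis holomorphic_on_imp_differentiable_at field_differentiable_def)
    then have "((\<lambda>w. qemb I (\<phi> w)) has_derivative (\<lambda>h. qemb I (D * h))) (at z)"
      unfolding has_field_derivative_def by (rule bounded_linear.has_derivative[OF qemb_bounded_linear])
    then have "((\<lambda>w. qlift \<phi> (qemb I w)) has_derivative (\<lambda>h. qemb I (D * h))) (at z)"
      by (rule has_derivative_transform_within_open[OF _ open_cdom[OF U(1)] z])
        (simp add: lift I)
    moreover have "qemb I (D * 1) + I * qemb I (D * \<i>) = 0"
    proof -
      have "I = qemb I \<i>" by (simp add: qemb_eq)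
      then have "I * qemb I (D * \<i>) = qemb I (\<i> * (D * \<i>))" by (metis qemb_mult I)
      also have "\<i> * (D * \<i>) = - (D * 1)" by (simp add: complex_eq_iff)
      finally show ?thesis by (simp add: qemb_minus)
    qed
    ultimately show "\<exists>f'. ((\<lambda>w. qlift \<phi> (qemb I w)) has_derivative f') (at z) \<and> f' 1 + I * f' \<i> = 0"
      by blast
  qed
qed

text \<open>Real coefficients commute with \<open>I\<close>, so a product with a slice preserving left factor has the stem that
is obtained by multiplying out as for complex numbers.\<close>

lemma slice_preserving_mult_stem:
  assumes f: "f \<in> SR U" "slice_preserving f U" and g: "g \<in> SR U"
    and I: "I \<in> qunits" and z: "z \<in> cdom U"
  shows "f (qemb I z) * g (qemb I z) =
      (Re (cstem qRe f z) *\<^sub>R stem1 g z - Im (cstem qRe f z) *\<^sub>R stem2 g z)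
      + I * (Re (cstem qRe f z) *\<^sub>R stem2 g z + Im (cstem qRe f z) *\<^sub>R stem1 g z)"
proof -
  have II: "I * (I * x) = - x" for x
    using qunits_square[OF I] by (simp flip: mult.assoc)
  show ?thesis
    unfolding slice_preserving_cstem[OF f I z] SR_stem[OF g I z]
    by (simp add: qemb_eq of_real_def algebra_simps II)
qed

text \<open>In the Leibniz rule the unit \<open>I\<close> has to be moved past the value of the left factor; it commutes with
that value because the value lies in the slice of \<open>I\<close>.\<close>

lemma SR_mult:
  assumes f: "f \<in> SR U" "slice_preserving f U" and g: "g \<in> SR U"
  shows "(\<lambda>q. f q * g q) \<in> SR U"
  unfolding SR_iff
proof (intro conjI ballI allI impI)
  show U: "open U" "circular U" using g by (simp_all add: SR_open SR_circular)
  define \<phi> where "\<phi> = cstem qRe f"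
  have sym: "\<phi> (cnj z) = cnj (\<phi> z)" for z
    unfolding \<phi>_def by (intro cstem_cnj bounded_linear.linear bounded_linear_quat_components)
  show "\<exists>F1 F2. (\<forall>z. F1 (cnj z) = F1 z \<and> F2 (cnj z) = - F2 z) \<and>
    (\<forall>I\<in>qunits. \<forall>z. qemb I z \<in> U \<longrightarrow> f (qemb I z) * g (qemb I z) = F1 z + I * F2 z)"
  proof (intro exI conjI allI ballI impI)
    fix I z assume I: "I \<in> qunits" and "qemb I z \<in> U"
    then have z: "z \<in> cdom U" by (simp add: qemb_mem_iff U)
    show "f (qemb I z) * g (qemb I z) =
      (Re (\<phi> z) *\<^sub>R stem1 g z - Im (\<phi> z) *\<^sub>R stem2 g z)
      + I * (Re (\<phi> z) *\<^sub>R stem2 g z + Im (\<phi> z) *\<^sub>R stem1 g z)"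
      unfolding \<phi>_def by (rule slice_preserving_mult_stem[OF f g I z])
  qed (simp_all add: sym)
  fix I z assume I: "I \<in> qunits" and z: "qemb I z \<in> U"
  then obtain f' g' where
    d: "((\<lambda>w. f (qemb I w)) has_derivative f') (at z)" "f' 1 + I * f' \<i> = 0"
    "((\<lambda>w. g (qemb I w)) has_derivative g') (at z)" "g' 1 + I * g' \<i> = 0"
    using f g unfolding SR_iff by meson
  have c: "I * f (qemb I z) = f (qemb I z) * I"
    using f(2) z I by (simp add: slice_preserving_iff flip: mem_slice_iff)
  have "(f (qemb I z) * g' 1 + f' 1 * g (qemb I z)) + I * (f (qemb I z) * g' \<i> + f' \<i> * g (qemb I z))
    = f (qemb I z) * (g' 1 + I * g' \<i>) + (f' 1 + I * f' \<i>) * g (qemb I z)"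
    using c by (simp add: algebra_simps flip: mult.assoc)
  also have "\<dots> = 0" by (simp add: d)
  finally show "\<exists>f'. ((\<lambda>w. f (qemb I w) * g (qemb I w)) has_derivative f') (at z) \<and> f' 1 + I * f' \<i> = 0"
    using has_derivative_mult[OF d(1,3)] by blast
qed

lemma SR_continuous:
  assumes "f \<in> SR U" "I \<in> qunits" "z \<in> cdom U"
  shows "isCont (\<lambda>w. f (qemb I w)) z"
  using assms qemb_mem_iff[OF SR_circular] unfolding SR_iff
  by (metis has_derivative_continuous qemb_mem_iff)

section \<open>Semi-regular functions and their classes\<close>

text \<open>Only continuity along a slice is involved, which is what real differentiability of the restrictions
provides.\<close>

lemma SR_eq_extend:
  assumes "f \<in> SR U" "g \<in> SR V" "I \<in> qunits" "z \<in> cdom U" "z \<in> cdom V"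
    and ev: "\<forall>\<^sub>F w in at z. f (qemb I w) = g (qemb I w)"
  shows "f (qemb I z) = g (qemb I z)"
proof -
  have "(\<lambda>w. f (qemb I w)) \<midarrow>z\<rightarrow> f (qemb I z)" "(\<lambda>w. g (qemb I w)) \<midarrow>z\<rightarrow> g (qemb I z)"
    using SR_continuous assms(1-5) by (blast intro: isContD)+
  then have "(\<lambda>w. f (qemb I w)) \<midarrow>z\<rightarrow> g (qemb I z)"
    using ev by (simp add: tendsto_cong)
  then show ?thesis
    using \<open>(\<lambda>w. f (qemb I w)) \<midarrow>z\<rightarrow> f (qemb I z)\<close> by (blast intro: LIM_unique)
qed

lemma slice_preserving_extend:
  assumes f: "f \<in> SR U"
    and ev: "\<And>I z. I \<in> qunits \<Longrightarrow> z \<in> cdom U \<Longrightarrow> \<forall>\<^sub>F w in at z. f (qemb I w) \<in> slice I"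
  shows "slice_preserving f U"
  unfolding slice_preserving_iff
proof (intro ballI allI impI)
  fix I z assume I: "I \<in> qunits" and "qemb I z \<in> U"
  then have z: "z \<in> cdom U" using SR_circular[OF f] by (simp add: qemb_mem_iff)
  have "slice I = {q. I * q = q * I}" using mem_slice_iff[OF I] by auto
  then have "closed (slice I)"
    by (simp add: closed_Collect_eq continuous_intros)
  then show "f (qemb I z) \<in> slice I"
    using Lim_in_closed_set[OF _ ev[OF I z] at_neq_bot] SR_continuous[OF f I z]
    by (simp add: isCont_def)
qed

text \<open>A uniform local condition at all points of \<open>\<Omega>\<close>, regular points included, saves case distinctions when
representatives with different singular sets are combined.\<close>

lemma sem_repsI:
  assumes "U \<subseteq> \<Omega>" "f \<in> SR U"
    and "\<And>p. p \<in> \<Omega> \<Longrightarrow> \<exists>N m g. open N \<and> circular N \<and> p \<in> N \<and> N \<subseteq> \<Omega> \<and> N - qsphere p \<subseteq> U \<and>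
      g \<in> SR N \<and> (\<forall>q\<in>N - qsphere p. g q = qDelta p q ^ m * f q)"
  shows "(U, f) \<in> sem_reps \<Omega>"
proof -
  have "\<exists>N. open N \<and> circular N \<and> p \<in> N \<and> N \<subseteq> \<Omega> \<and> N - qsphere p \<subseteq> U \<and>
      (\<exists>(m::nat) g. g \<in> SR N \<and> (\<forall>q\<in>N - qsphere p. g q = qDelta p q ^ m * f q))"
    if p: "p \<in> \<Omega>" for p
  proof -
    obtain N m g where "open N \<and> circular N \<and> p \<in> N \<and> N \<subseteq> \<Omega> \<and> N - qsphere p \<subseteq> U \<and>
      g \<in> SR N \<and> (\<forall>q\<in>N - qsphere p. g q = qDelta p q ^ m * f q)"
      using assms(3)[OF p] by (elim exE) (rule that)
    then show ?thesis
      by (intro exI[of _ N] conjI exI[of _ m] exI[of _ g]) simp_all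
  qed
  with assms(1,2) show ?thesis by (simp add: sem_reps_def)
qed

lemma sem_repsD:
  assumes "(U, f) \<in> sem_reps \<Omega>"
  shows "U \<subseteq> \<Omega>" "f \<in> SR U"
  using assms unfolding sem_reps_def by auto

text \<open>At a point of the domain the domain itself is a neighbourhood, with exponent \<open>0\<close>.\<close>

lemma sem_reps_local:
  assumes "(U, f) \<in> sem_reps \<Omega>" "p \<in> \<Omega>"
  obtains N m g where "open N" "circular N" "p \<in> N" "N \<subseteq> \<Omega>" "N - qsphere p \<subseteq> U"
    "g \<in> SR N" "\<And>q. q \<in> N - qsphere p \<Longrightarrow> g q = qDelta p q ^ m * f q"
proof (cases "p \<in> U")
  case True
  show thesis
    by (rule that[of U f 0]) (use True assms in \<open>auto simp: SR_open SR_circular dest: sem_repsD\<close>)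
next
  case False
  with assms have "\<exists>N. open N \<and> circular N \<and> p \<in> N \<and> N \<subseteq> \<Omega> \<and> N - qsphere p \<subseteq> U \<and>
      (\<exists>(m::nat) g. g \<in> SR N \<and> (\<forall>q\<in>N - qsphere p. g q = qDelta p q ^ m * f q))"
    by (simp add: sem_reps_def)
  then show thesis by (elim exE conjE) (rule that, assumption+, blast)
qed

lemma open_qsphere_Diff: "open N \<Longrightarrow> open (N - qsphere p)"
proof -
  have "open (qproj -` (- {qproj p}))" by (intro open_qproj_vimage) auto
  moreover have "N - qsphere p = N \<inter> qproj -` (- {qproj p})"
    by (auto simp: qsphere_conv)
  ultimately show "open N \<Longrightarrow> open (N - qsphere p)" by auto
qed

lemma cdom_Int [simp]: "cdom (U \<inter> V) = cdom U \<inter> cdom V"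
  by (auto simp: cdom_def)

lemma eventually_cdom_punctured:
  assumes "open N" "z \<in> cdom N" "qproj p = z \<or> qproj p = cnj z"
  shows "\<forall>\<^sub>F w in at z. w \<in> cdom (N - qsphere p)"
proof -
  have "\<forall>\<^sub>F w in at z. w \<in> cdom N"
    using assms open_cdom eventually_at_topological by blast
  moreover have "\<forall>\<^sub>F w in at z. w \<noteq> z \<and> w \<noteq> cnj z"
    by (simp add: eventually_conj_iff eventually_neq_at_within)
  ultimately show ?thesis
    by eventually_elim (use assms(3) in \<open>auto simp: cdom_def qemb_mem_qsphere_iff\<close>)
qed

text \<open>The points missing from a domain lie on isolated spheres, and a sphere meets the slice of \<open>qi\<close> in at
most two points.\<close>

lemma sem_reps_dense:
  assumes rep: "(U, f) \<in> sem_reps \<Omega>" and \<Omega>: "circular \<Omega>" and z: "z \<in> cdom \<Omega>"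
  shows "\<forall>\<^sub>F w in at z. w \<in> cdom U"
proof -
  have "qemb qi z \<in> \<Omega>" using z by (simp add: cdom_def)
  from rep this obtain N m g where N: "open N" "circular N" "qemb qi z \<in> N"
    "N - qsphere (qemb qi z) \<subseteq> U"
    by (rule sem_reps_local)
  have "\<forall>\<^sub>F w in at z. w \<in> cdom (N - qsphere (qemb qi z))"
    using N qproj_qemb_cases[of qi z] by (intro eventually_cdom_punctured) (auto simp: cdom_def)
  then show ?thesis
    by eventually_elim (use N(4) cdom_mono in blast)
qed

text \<open>The identity principle used throughout: agreement on the part of the common domain that lies in a third
domain \<open>W\<close> is agreement, as \<open>W\<close> is dense in every slice. With \<open>W\<close> the middle domain this is the transitivity
of the relation between representatives.\<close>

lemma sem_reps_eq_dense:
  assumes \<Omega>: "circular \<Omega>"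
    and rep: "(U, f) \<in> sem_reps \<Omega>" "(V, g) \<in> sem_reps \<Omega>" "(W, h) \<in> sem_reps \<Omega>"
    and eq: "\<And>q. q \<in> U \<inter> V \<inter> W \<Longrightarrow> f q = g q" and q: "q \<in> U \<inter> V"
  shows "f q = g q"
proof -
  have circ: "circular U" "circular V" "circular W"
    using rep by (auto dest: sem_repsD(2) SR_circular)
  obtain I z where z: "I \<in> qunits" "q = qemb I z" by (rule qemb_cases)
  then have zU: "z \<in> cdom U" "z \<in> cdom V" "z \<in> cdom \<Omega>"
    using q circ \<Omega> sem_repsD(1)[OF rep(1)] by (auto simp flip: qemb_mem_iff)
  have "\<forall>\<^sub>F w in at z. w \<in> cdom U \<and> w \<in> cdom V \<and> w \<in> cdom W"
    using rep[THEN sem_reps_dense, OF \<Omega> zU(3)] by (simp add: eventually_conj_iff)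
  then have "\<forall>\<^sub>F w in at z. f (qemb I w) = g (qemb I w)"
    by eventually_elim (use eq z circ in \<open>simp add: qemb_mem_iff\<close>)
  then show ?thesis
    unfolding z(2) using SR_eq_extend rep[THEN sem_repsD(2)] z(1) zU by blast
qed

definition sem_class :: "quat set \<Rightarrow> quat set \<Rightarrow> (quat \<Rightarrow> quat) \<Rightarrow> sem" where
  "sem_class \<Omega> U f = sem_rel \<Omega> `` {(U, f)}"

lemma equiv_sem_rel: "circular \<Omega> \<Longrightarrow> equiv (sem_reps \<Omega>) (sem_rel \<Omega>)"
proof (rule equivI)
  assume \<Omega>: "circular \<Omega>"
  show "trans (sem_rel \<Omega>)"
  proof (rule transI)
    fix x y z assume "(x, y) \<in> sem_rel \<Omega>" "(y, z) \<in> sem_rel \<Omega>"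
    then show "(x, z) \<in> sem_rel \<Omega>"
      using sem_reps_eq_dense[OF \<Omega>, of "fst x" "snd x" "fst z" "snd z" "fst y" "snd y"]
      by (auto simp: sem_rel_def)
  qed
qed (auto simp: sem_rel_def refl_on_def sym_def)

lemma mem_sem_class:
  "(V, g) \<in> sem_class \<Omega> U f \<longleftrightarrow>
    (U, f) \<in> sem_reps \<Omega> \<and> (V, g) \<in> sem_reps \<Omega> \<and> (\<forall>q\<in>U \<inter> V. f q = g q)"
  by (auto simp: sem_class_def sem_rel_def)

lemma sem_class_eq_iff:
  assumes "circular \<Omega>" "(U, f) \<in> sem_reps \<Omega>" "(V, g) \<in> sem_reps \<Omega>"
  shows "sem_class \<Omega> U f = sem_class \<Omega> V g \<longleftrightarrow> (\<forall>q\<in>U \<inter> V. f q = g q)"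
proof -
  have "sem_class \<Omega> U f = sem_class \<Omega> V g \<longleftrightarrow> ((U, f), (V, g)) \<in> sem_rel \<Omega>"
    unfolding sem_class_def
    using eq_equiv_class_iff[OF equiv_sem_rel assms(2,3)] assms(1) by blast
  then show ?thesis using assms by (simp add: sem_rel_def)
qed

text \<open>The lifted operation is a union over all pairs of representatives; the union is over copies of one class
because any two representatives agree on their common domain.\<close>

lemma sem_lift2_class:
  assumes \<Omega>: "circular \<Omega>" and rep: "(U, f) \<in> sem_reps \<Omega>" "(V, g) \<in> sem_reps \<Omega>"
    and op: "\<And>U' f' V' g'. (U', f') \<in> sem_class \<Omega> U f \<Longrightarrow> (V', g') \<in> sem_class \<Omega> V g \<Longrightarrow>
      (U' \<inter> V', \<lambda>q. op (f' q) (g' q)) \<in> sem_reps \<Omega>"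
  shows "sem_lift2 \<Omega> op (sem_class \<Omega> U f) (sem_class \<Omega> V g) =
    sem_class \<Omega> (U \<inter> V) (\<lambda>q. op (f q) (g q))"
proof -
  have self: "(U, f) \<in> sem_class \<Omega> U f" "(V, g) \<in> sem_class \<Omega> V g"
    using rep by (auto simp: mem_sem_class)
  have "sem_class \<Omega> (U' \<inter> V') (\<lambda>q. op (f' q) (g' q)) = sem_class \<Omega> (U \<inter> V) (\<lambda>q. op (f q) (g q))"
    if "(U', f') \<in> sem_class \<Omega> U f" "(V', g') \<in> sem_class \<Omega> V g" for U' f' V' g'
    using sem_class_eq_iff[OF \<Omega> op[OF that] op[OF self]] that by (auto simp: mem_sem_class)
  then have "sem_lift2 \<Omega> op (sem_class \<Omega> U f) (sem_class \<Omega> V g) =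
    (\<Union>x\<in>sem_class \<Omega> U f. \<Union>y\<in>sem_class \<Omega> V g. sem_class \<Omega> (U \<inter> V) (\<lambda>q. op (f q) (g q)))"
    unfolding sem_lift2_def sem_class_def[symmetric] by (intro SUP_cong refl) auto
  also have "\<dots> = sem_class \<Omega> (U \<inter> V) (\<lambda>q. op (f q) (g q))"
    using self by auto
  finally show ?thesis .
qed

lemma qDelta_power_SR:
  assumes "open U" "circular U"
  shows "(\<lambda>q. qDelta p q ^ m) \<in> SR U" "slice_preserving (\<lambda>q. qDelta p q ^ m) U"
proof -
  define \<delta> where "\<delta> w = ((w - qproj p) * (w - cnj (qproj p))) ^ m" for w
  have sym: "\<delta> (cnj w) = cnj (\<delta> w)" for w by (simp add: \<delta>_def mult.commute)
  have D: "qDelta p (qemb I w) ^ m = qemb I (\<delta> w)" if "I \<in> qunits" for I w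
    using that by (simp add: \<delta>_def qDelta_qemb qemb_power)
  have "\<delta> holomorphic_on cdom U" unfolding \<delta>_def by (intro holomorphic_intros)
  then have "qlift \<delta> \<in> SR U" using assms sym by (intro SR_qlift)
  then show "(\<lambda>q. qDelta p q ^ m) \<in> SR U"
  proof (rule SR_cong)
    fix q obtain I z where "I \<in> qunits" "q = qemb I z" by (rule qemb_cases)
    then show "qDelta p q ^ m = qlift \<delta> q" by (simp add: D qlift_qemb sym)
  qed (use assms in auto)
  show "slice_preserving (\<lambda>q. qDelta p q ^ m) U"
    by (simp add: slice_preserving_iff D)
qed

lemma slice_qDelta_power: "I \<in> qunits \<Longrightarrow> qDelta p (qemb I w) ^ k \<in> slice I"
  using qDelta_power_SR(2)[of UNIV p k] by (auto simp: slice_preserving_iff circular_iff)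

text \<open>Away from the sphere of \<open>p\<close> the numerator is a product of values in one slice; on the sphere its values
are limits of such values along the slice, and slices are closed.\<close>

lemma slice_preserving_numerator:
  assumes \<Omega>: "circular \<Omega>" and rep: "(U, f) \<in> sem_reps \<Omega>" and sp: "slice_preserving f U"
    and N: "g \<in> SR N" "N \<subseteq> \<Omega>" "\<And>q. q \<in> N - qsphere p \<Longrightarrow> g q = qDelta p q ^ m * f q"
  shows "slice_preserving g N"
proof (rule slice_preserving_extend[OF N(1)])
  note circ = SR_circular[OF sem_repsD(2)[OF rep]] SR_circular[OF N(1)]
  fix I z assume I: "I \<in> qunits" and z: "z \<in> cdom N"
  have "\<forall>\<^sub>F w in at z. w \<in> cdom U"
    using sem_reps_dense[OF rep \<Omega>] z cdom_mono[OF N(2)] by blast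
  moreover have "\<forall>\<^sub>F w in at z. w \<in> cdom N"
    using open_cdom[OF SR_open[OF N(1)]] z eventually_at_topological by blast
  moreover have "\<forall>\<^sub>F w in at z. w \<noteq> qproj p \<and> w \<noteq> cnj (qproj p)"
    by (simp add: eventually_conj_iff eventually_neq_at_within)
  ultimately show "\<forall>\<^sub>F w in at z. g (qemb I w) \<in> slice I"
  proof eventually_elim
    case (elim w)
    then have "qemb I w \<in> N - qsphere p" "qemb I w \<in> U"
      using I circ by (simp_all add: qemb_mem_iff qemb_mem_qsphere_iff)
    then show ?case
      using N(3) slice_qDelta_power[OF I] sp I by (simp add: slice_mult slice_preserving_iff)
  qed
qed

text \<open>Near \<open>p\<close> bring both summands to the common denominator \<open>\<Delta>\<^sub>p\<^bsup>m+n\<^esup>\<close>.\<close>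

lemma sem_reps_add:
  assumes \<Omega>: "circular \<Omega>" and rep: "(U, f) \<in> sem_reps \<Omega>" "(V, g) \<in> sem_reps \<Omega>"
  shows "(U \<inter> V, \<lambda>q. f q + g q) \<in> sem_reps \<Omega>"
proof (rule sem_repsI)
  note UV = rep[THEN sem_repsD(2), THEN SR_open] rep[THEN sem_repsD(2), THEN SR_circular]
  show "U \<inter> V \<subseteq> \<Omega>" using rep by (auto dest: sem_repsD)
  show "(\<lambda>q. f q + g q) \<in> SR (U \<inter> V)"
    using UV by (intro SR_add SR_subset[OF sem_repsD(2)[OF rep(1)]] SR_subset[OF sem_repsD(2)[OF rep(2)]])
      (auto intro: circular_Int)
  fix p assume p: "p \<in> \<Omega>"
  from rep(1) p obtain M m f' where M: "open M" "circular M" "p \<in> M" "M \<subseteq> \<Omega>" "M - qsphere p \<subseteq> U"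
    "f' \<in> SR M" "\<And>q. q \<in> M - qsphere p \<Longrightarrow> f' q = qDelta p q ^ m * f q"
    by (rule sem_reps_local) (rule that)
  from rep(2) p obtain N n g' where N: "open N" "circular N" "p \<in> N" "N \<subseteq> \<Omega>" "N - qsphere p \<subseteq> V"
    "g' \<in> SR N" "\<And>q. q \<in> N - qsphere p \<Longrightarrow> g' q = qDelta p q ^ n * g q"
    by (rule sem_reps_local) (rule that)
  have MN: "open (M \<inter> N)" "circular (M \<inter> N)" using M N by (auto intro: circular_Int)
  show "\<exists>N' k h. open N' \<and> circular N' \<and> p \<in> N' \<and> N' \<subseteq> \<Omega> \<and> N' - qsphere p \<subseteq> U \<inter> V \<and>
      h \<in> SR N' \<and> (\<forall>q\<in>N' - qsphere p. h q = qDelta p q ^ k * (f q + g q))"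
  proof (rule exI[of _ "M \<inter> N"], rule exI[of _ "m + n"], intro exI conjI)
    show "(\<lambda>q. qDelta p q ^ n * f' q + qDelta p q ^ m * g' q) \<in> SR (M \<inter> N)"
      by (intro SR_add SR_mult qDelta_power_SR SR_subset[OF M(6)] SR_subset[OF N(6)] MN) auto
    show "\<forall>q\<in>M \<inter> N - qsphere p. qDelta p q ^ n * f' q + qDelta p q ^ m * g' q
        = qDelta p q ^ (m + n) * (f q + g q)"
    proof
      fix q assume "q \<in> M \<inter> N - qsphere p"
      then have "f' q = qDelta p q ^ m * f q" "g' q = qDelta p q ^ n * g q" using M N by auto
      moreover have "qDelta p q ^ (m + n) = qDelta p q ^ n * qDelta p q ^ m"
        by (subst add.commute) (rule power_add)
      moreover from this have "qDelta p q ^ (m + n) * f q = qDelta p q ^ n * (qDelta p q ^ m * f q)"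
        by (simp only: mult.assoc)
      moreover have "qDelta p q ^ (m + n) * g q = qDelta p q ^ m * (qDelta p q ^ n * g q)"
        by (simp only: mult.assoc power_add)
      ultimately show "qDelta p q ^ n * f' q + qDelta p q ^ m * g' q
        = qDelta p q ^ (m + n) * (f q + g q)"
        by (simp only: distrib_left)
    qed
  qed (use M(1-5) N(1-5) MN in auto)
qed

text \<open>The denominators multiply to \<open>\<Delta>\<^sub>p\<^bsup>m+n\<^esup>\<close> once the denominator of \<open>g\<close> is moved past the values of \<open>f\<close>,
with which it commutes because \<open>f\<close> preserves slices. The numerator of \<open>f\<close> preserves slices as
well (\<open>slice_preserving_numerator\<close>), so the product of the numerators is regular.\<close>

lemma sem_reps_mult:
  assumes \<Omega>: "circular \<Omega>" and rep: "(U, f) \<in> sem_reps \<Omega>" "(V, g) \<in> sem_reps \<Omega>"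
    and sp: "slice_preserving f U"
  shows "(U \<inter> V, \<lambda>q. f q * g q) \<in> sem_reps \<Omega>"
proof (rule sem_repsI)
  note UV = rep[THEN sem_repsD(2), THEN SR_open] rep[THEN sem_repsD(2), THEN SR_circular]
  show "U \<inter> V \<subseteq> \<Omega>" using rep by (auto dest: sem_repsD)
  show "(\<lambda>q. f q * g q) \<in> SR (U \<inter> V)"
    using UV sp
    by (intro SR_mult SR_subset[OF sem_repsD(2)[OF rep(1)]] SR_subset[OF sem_repsD(2)[OF rep(2)]])
      (auto intro: circular_Int simp: slice_preserving_iff)
  fix p assume p: "p \<in> \<Omega>"
  from rep(1) p obtain M m f' where M: "open M" "circular M" "p \<in> M" "M \<subseteq> \<Omega>" "M - qsphere p \<subseteq> U"
    "f' \<in> SR M" "\<And>q. q \<in> M - qsphere p \<Longrightarrow> f' q = qDelta p q ^ m * f q"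
    by (rule sem_reps_local) (rule that)
  from rep(2) p obtain N n g' where N: "open N" "circular N" "p \<in> N" "N \<subseteq> \<Omega>" "N - qsphere p \<subseteq> V"
    "g' \<in> SR N" "\<And>q. q \<in> N - qsphere p \<Longrightarrow> g' q = qDelta p q ^ n * g q"
    by (rule sem_reps_local) (rule that)
  have MN: "open (M \<inter> N)" "circular (M \<inter> N)" using M N by (auto intro: circular_Int)
  have sf': "slice_preserving f' M"
    using M by (intro slice_preserving_numerator[OF \<Omega> rep(1) sp, of f' M p m]) auto
  show "\<exists>N' k h. open N' \<and> circular N' \<and> p \<in> N' \<and> N' \<subseteq> \<Omega> \<and> N' - qsphere p \<subseteq> U \<inter> V \<and>
      h \<in> SR N' \<and> (\<forall>q\<in>N' - qsphere p. h q = qDelta p q ^ k * (f q * g q))"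
  proof (rule exI[of _ "M \<inter> N"], rule exI[of _ "m + n"], intro exI conjI)
    show "(\<lambda>q. f' q * g' q) \<in> SR (M \<inter> N)"
      using sf' by (intro SR_mult SR_subset[OF M(6)] SR_subset[OF N(6)] MN)
        (auto simp: slice_preserving_iff)
    show "\<forall>q\<in>M \<inter> N - qsphere p. f' q * g' q = qDelta p q ^ (m + n) * (f q * g q)"
    proof
      fix q assume q: "q \<in> M \<inter> N - qsphere p"
      obtain I z where I: "I \<in> qunits" "q = qemb I z" by (rule qemb_cases)
      have "f q * qDelta p q ^ n = qDelta p q ^ n * f q"
      proof (rule slice_commute[OF I(1)])
        show "f q \<in> slice I" using sp q M(5) I by (auto simp: slice_preserving_iff)
      qed (use slice_qDelta_power I in auto)
      then have "qDelta p q ^ m * f q * (qDelta p q ^ n * g q) = qDelta p q ^ m * (qDelta p q ^ n * f q) * g q"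
        by (metis mult.assoc)
      moreover have "f' q = qDelta p q ^ m * f q" "g' q = qDelta p q ^ n * g q" using M N q by auto
      ultimately show "f' q * g' q = qDelta p q ^ (m + n) * (f q * g q)"
        by (simp only: power_add mult.assoc)
    qed
  qed (use M(1-5) N(1-5) MN in auto)
qed

text \<open>Slice preservation does not depend on the representative, so the defining condition of the scalar field
needs to be checked on one representative only.\<close>

lemma slice_preserving_class:
  assumes \<Omega>: "circular \<Omega>" and "(V, g) \<in> sem_class \<Omega> U f" and sp: "slice_preserving f U"
  shows "slice_preserving g V"
proof -
  have rep: "(U, f) \<in> sem_reps \<Omega>" "(V, g) \<in> sem_reps \<Omega>" and eq: "\<And>q. q \<in> U \<inter> V \<Longrightarrow> f q = g q"
    using assms(2) by (auto simp: mem_sem_class)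
  note circ = rep[THEN sem_repsD(2), THEN SR_circular]
  show ?thesis
  proof (rule slice_preserving_extend[OF sem_repsD(2)[OF rep(2)]])
    fix I z assume I: "I \<in> qunits" and "z \<in> cdom V"
    then have "z \<in> cdom \<Omega>" using cdom_mono[OF sem_repsD(1)[OF rep(2)]] by blast
    from rep[THEN sem_reps_dense, OF \<Omega> this]
    show "\<forall>\<^sub>F w in at z. g (qemb I w) \<in> slice I"
    proof eventually_elim
      case (elim w)
      then have w: "qemb I w \<in> U \<inter> V" using I circ by (simp add: qemb_mem_iff)
      then have "f (qemb I w) \<in> slice I" using sp I by (simp add: slice_preserving_iff)
      then show ?case using eq[OF w] by simp
    qed
  qed
qed

lemma sem_reps_const: "open \<Omega> \<Longrightarrow> circular \<Omega> \<Longrightarrow> (\<Omega>, \<lambda>_. c) \<in> sem_reps \<Omega>"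
  by (auto simp: sem_reps_def SR_const)

lemma sem_const_class: "sem_const \<Omega> c = sem_class \<Omega> \<Omega> (\<lambda>_. c)"
  by (simp add: sem_const_def sem_class_def)

lemma slice_preserving_const: "c \<in> \<real> \<Longrightarrow> slice_preserving (\<lambda>_. c) U"
  by (metis Reals_cases qemb_mem_slice qemb_of_real slice_preserving_iff)

lemma carrier_SEM_iff: "A \<in> carrier (SEM \<Omega>) \<longleftrightarrow> (\<exists>U f. (U, f) \<in> sem_reps \<Omega> \<and> A = sem_class \<Omega> U f)"
  by (simp add: SEM_def quotient_def sem_class_def Bex_def)

lemma carrier_SEM_R_iff:
  assumes "circular \<Omega>"
  shows "A \<in> carrier (SEM_R \<Omega>) \<longleftrightarrow>
    (\<exists>U f. (U, f) \<in> sem_reps \<Omega> \<and> slice_preserving f U \<and> A = sem_class \<Omega> U f)"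
proof -
  have "(\<forall>(V, g)\<in>sem_class \<Omega> U f. slice_preserving g V) \<longleftrightarrow> slice_preserving f U"
    if "(U, f) \<in> sem_reps \<Omega>" for U f
  proof
    assume *: "\<forall>(V, g)\<in>sem_class \<Omega> U f. slice_preserving g V"
    have "(U, f) \<in> sem_class \<Omega> U f" using that by (simp add: mem_sem_class)
    with * show "slice_preserving f U" by blast
  qed (use slice_preserving_class[OF assms] in blast)
  moreover have "A \<in> carrier (SEM_R \<Omega>) \<longleftrightarrow>
    A \<in> carrier (SEM \<Omega>) \<and> (\<forall>(V, g)\<in>A. slice_preserving g V)"
    by (simp add: SEM_R_def SEM_def)
  ultimately show ?thesis
    unfolding carrier_SEM_iff by metis
qed

lemma sem_add_class:
  assumes \<Omega>: "circular \<Omega>" and rep: "(U, f) \<in> sem_reps \<Omega>" "(V, g) \<in> sem_reps \<Omega>"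
  shows "sem_add \<Omega> (sem_class \<Omega> U f) (sem_class \<Omega> V g) = sem_class \<Omega> (U \<inter> V) (\<lambda>q. f q + g q)"
  by (rule sem_lift2_class[OF assms]) (auto simp: mem_sem_class intro: sem_reps_add[OF \<Omega>])

lemma sem_mult_class:
  assumes \<Omega>: "circular \<Omega>" and rep: "(U, f) \<in> sem_reps \<Omega>" "(V, g) \<in> sem_reps \<Omega>"
    and sp: "slice_preserving f U"
  shows "sem_mult \<Omega> (sem_class \<Omega> U f) (sem_class \<Omega> V g) = sem_class \<Omega> (U \<inter> V) (\<lambda>q. f q * g q)"
proof (rule sem_lift2_class[OF \<Omega> rep])
  fix U' f' V' g' assume *: "(U', f') \<in> sem_class \<Omega> U f" "(V', g') \<in> sem_class \<Omega> V g"
  then have "slice_preserving f' U'" using slice_preserving_class[OF \<Omega> _ sp] by blast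
  then show "(U' \<inter> V', \<lambda>q. f' q * g' q) \<in> sem_reps \<Omega>"
    using * by (auto simp: mem_sem_class intro: sem_reps_mult[OF \<Omega>])
qed

section \<open>Reciprocals\<close>

lemma tendsto_cnj_reflect:
  assumes "(f \<longlongrightarrow> L) (at z)"
  shows "((\<lambda>w. cnj (f (cnj w))) \<longlongrightarrow> cnj L) (at (cnj z))"
proof -
  have "filterlim cnj (at z) (at (cnj z))"
  proof (rule filterlim_atI)
    show "(cnj \<longlongrightarrow> z) (at (cnj z))"
      using tendsto_cnj[OF tendsto_ident_at[of "cnj z" UNIV]] by simp
    show "\<forall>\<^sub>F w in at (cnj z). cnj w \<noteq> z"
      using eventually_neq_at_within[of "cnj z"] by eventually_elim auto
  qed
  from tendsto_cnj[OF filterlim_compose[OF assms this]] show ?thesis .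
qed

text \<open>The complex core of the inversion. If the zero of \<open>\<psi>\<close> at \<open>z0\<close> has order \<open>n\<close>, then \<open>\<psi>(z) = (z - z0)\<^sup>n g(z)\<close>
with zero-free \<open>g\<close>, and the quotient in question is \<open>(z - cnj z0)\<^sup>n / g(z)\<close> near \<open>z0\<close>. By symmetry the same
happens at \<open>cnj z0\<close>. Filling in the two limits makes the quotient continuous, hence holomorphic. Working
with removable singularities treats real and non-real \<open>z0\<close> alike, although for real \<open>z0\<close> the factor
\<open>\<Delta>\<close> vanishes doubly there.\<close>

lemma reciprocal_extends:
  fixes \<psi> :: "complex \<Rightarrow> complex" and z0 :: complex
  assumes D: "open D" "z0 \<in> D" "\<And>z. z \<in> D \<Longrightarrow> cnj z \<in> D"
    and hol: "\<psi> holomorphic_on D" and sym: "\<And>z. z \<in> D \<Longrightarrow> \<psi> (cnj z) = cnj (\<psi> z)"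
    and nz: "\<not> (\<forall>\<^sub>F w in at z0. \<psi> w = 0)"
  obtains r n \<eta> where "r > 0" "ball z0 r \<union> ball (cnj z0) r \<subseteq> D"
    "\<eta> holomorphic_on ball z0 r \<union> ball (cnj z0) r"
    "\<And>z. z \<in> ball z0 r \<union> ball (cnj z0) r \<Longrightarrow> \<eta> (cnj z) = cnj (\<eta> z)"
    "\<And>z. z \<in> ball z0 r \<union> ball (cnj z0) r - {z0, cnj z0} \<Longrightarrow>
      \<psi> z \<noteq> 0 \<and> \<eta> z = ((z - z0) * (z - cnj z0)) ^ n / \<psi> z"
proof -
  obtain e where e: "e > 0" "ball z0 e \<subseteq> D" using D openE by blast
  have ne: "\<exists>w\<in>ball z0 e. \<psi> w \<noteq> 0"
  proof (rule ccontr)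
    assume "\<not> ?thesis"
    then have "\<forall>\<^sub>F w in at z0. \<psi> w = 0"
      using e(1) eventually_at_topological[of "\<lambda>w. \<psi> w = 0"] by (metis open_ball centre_in_ball)
    with nz show False ..
  qed
  define n where "n = nat (zorder \<psi> z0)"
  define g where "g = zor_poly \<psi> z0"
  obtain r where r: "r > 0" "cball z0 r \<subseteq> ball z0 e" "g holomorphic_on cball z0 r"
    "\<And>w. w \<in> cball z0 r \<Longrightarrow> \<psi> w = g w * (w - z0) ^ n \<and> g w \<noteq> 0"
    using zorder_exist_zero[OF holomorphic_on_subset[OF hol e(2)] open_ball connected_ball
        centre_in_ball[THEN iffD2, OF e(1)] ne]
    unfolding n_def g_def by blast
  define W where "W = ball z0 r \<union> ball (cnj z0) r"
  have W: "open W" "z0 \<in> W" "cnj z0 \<in> W" using r(1) by (auto simp: W_def)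
  have cnj_ball: "cnj z \<in> ball (cnj z0) r \<longleftrightarrow> z \<in> ball z0 r" for z
    by (metis complex_cnj_diff complex_mod_cnj dist_norm mem_ball)
  then have cnj_ball': "cnj z \<in> ball z0 r \<longleftrightarrow> z \<in> ball (cnj z0) r" for z
    by (metis complex_cnj_cnj)
  have symW: "cnj z \<in> W \<longleftrightarrow> z \<in> W" for z
    using cnj_ball cnj_ball' by (auto simp: W_def)
  have ball_D: "ball z0 r \<subseteq> D" using r(2) e(2) by (meson ball_subset_cball order_trans)
  have WD: "W \<subseteq> D"
  proof
    fix z assume "z \<in> W"
    then have "z \<in> D \<or> cnj z \<in> D" using ball_D cnj_ball'[of z] unfolding W_def by blast
    then show "z \<in> D" using D(3) by (metis complex_cnj_cnj)
  qed
  have nz: "\<psi> z \<noteq> 0" if z: "z \<in> W - {z0, cnj z0}" for z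
  proof -
    have ball: "\<psi> w \<noteq> 0" if "w \<in> ball z0 r" "w \<noteq> z0" for w
      using r(4)[of w] that by auto
    have "cnj (\<psi> z) = \<psi> (cnj z)" using sym z WD by auto
    moreover have "cnj z \<noteq> z0" using z by auto
    ultimately show ?thesis
      using z ball[of z] ball[of "cnj z"] cnj_ball' by (auto simp: W_def)
  qed
  define \<rho> where "\<rho> z = ((z - z0) * (z - cnj z0)) ^ n / \<psi> z" for z
  have \<rho>_cnj: "\<rho> (cnj z) = cnj (\<rho> z)" if "z \<in> W" for z
    using sym[of z] that WD by (auto simp: \<rho>_def mult.commute)
  define L where "L = (z0 - cnj z0) ^ n / g z0"
  have lim: "(\<rho> \<longlongrightarrow> L) (at z0)"
  proof (rule Lim_transform_eventually)
    have "g z0 \<noteq> 0" using r(1,4) by auto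
    moreover have "isCont g z0"
      using holomorphic_on_imp_continuous_on[OF r(3)] r(1) by (simp add: continuous_on_interior)
    ultimately have "isCont (\<lambda>z. (z - cnj z0) ^ n / g z) z0" by (intro continuous_intros)
    then show "((\<lambda>z. (z - cnj z0) ^ n / g z) \<longlongrightarrow> L) (at z0)" by (simp add: L_def isCont_def)
    have "\<forall>\<^sub>F z in at z0. z \<in> ball z0 r \<and> z \<noteq> z0"
      using r(1) eventually_at_in_open[of "ball z0 r" z0] by (auto elim: eventually_mono)
    then show "\<forall>\<^sub>F z in at z0. (z - cnj z0) ^ n / g z = \<rho> z"
    proof eventually_elim
      case (elim z)
      then have "\<psi> z = g z * (z - z0) ^ n" "g z \<noteq> 0" using r(4)[of z] by auto
      then show ?case using elim by (simp add: \<rho>_def power_mult_distrib)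
    qed
  qed
  have lim': "(\<rho> \<longlongrightarrow> cnj L) (at (cnj z0))"
  proof (rule Lim_transform_eventually[OF tendsto_cnj_reflect[OF lim]])
    have "\<forall>\<^sub>F z in at (cnj z0). z \<in> W"
      using W eventually_at_topological by blast
    then show "\<forall>\<^sub>F z in at (cnj z0). cnj (\<rho> (cnj z)) = \<rho> z"
      by eventually_elim (simp add: \<rho>_cnj)
  qed
  \<comment> \<open>For real \<open>z0\<close> both limits are taken at the same point, so \<open>\<eta>\<close> below is real there.\<close>
  have L: "cnj L = L" if "cnj z0 = z0"
    using lim lim' that by (metis LIM_unique)
  define \<eta> where "\<eta> z = (if z = z0 then L else if z = cnj z0 then cnj L else \<rho> z)" for z
  have \<eta>_lim: "(\<eta> \<longlongrightarrow> \<eta> k) (at k)" if k: "k \<in> {z0, cnj z0}" for k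
  proof (rule Lim_transform_eventually)
    show "(\<rho> \<longlongrightarrow> \<eta> k) (at k)"
      using lim lim' k by (auto simp: \<eta>_def)
    have "\<forall>\<^sub>F z in at k. z \<noteq> z0 \<and> z \<noteq> cnj z0"
      by (simp add: eventually_conj_iff eventually_neq_at_within)
    then show "\<forall>\<^sub>F z in at k. \<rho> z = \<eta> z"
      by eventually_elim (simp add: \<eta>_def)
  qed
  show thesis
  proof (rule that[of r \<eta> n, folded W_def])
    show "\<eta> holomorphic_on W"
    proof (rule no_isolated_singularity'[of "{z0, cnj z0}"])
      have "\<rho> holomorphic_on W - {z0, cnj z0}"
        unfolding \<rho>_def by (intro holomorphic_intros holomorphic_on_subset[OF hol])
          (use nz WD in auto)
      then show "\<eta> holomorphic_on W - {z0, cnj z0}"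
        by (rule holomorphic_transform) (simp add: \<eta>_def)
    qed (use \<eta>_lim W in \<open>auto intro: tendsto_within_subset\<close>)
    show "\<eta> (cnj z) = cnj (\<eta> z)" if "z \<in> W" for z
    proof -
      have "cnj z = z0 \<longleftrightarrow> z = cnj z0" by auto
      then show ?thesis using \<rho>_cnj[OF that] L by (auto simp: \<eta>_def)
    qed
  qed (use r(1) WD nz in \<open>auto simp: \<eta>_def \<rho>_def\<close>)
qed

text \<open>A punctured neighbourhood of \<open>z\<close> is a neighbourhood of each of its points.\<close>

lemma open_eventually_at:
  fixes P :: "'a::t1_space \<Rightarrow> bool"
  shows "open {z. eventually P (at z)}"
proof (subst open_subopen, safe)
  fix z assume "eventually P (at z)"
  then obtain S where S: "open S" "z \<in> S" "\<And>w. w \<in> S \<Longrightarrow> w \<noteq> z \<Longrightarrow> P w"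
    unfolding eventually_at_topological by blast
  have "eventually P (at w)" if "w \<in> S" for w
  proof (cases "w = z")
    case True then show ?thesis using S unfolding eventually_at_topological by blast
  next
    case False
    then show ?thesis
      using S that open_Diff[OF S(1) closed_singleton[of z]] unfolding eventually_at_topological
      by (intro exI[of _ "S - {z}"]) auto
  qed
  then show "\<exists>T. open T \<and> z \<in> T \<and> T \<subseteq> {z. eventually P (at z)}"
    using S by blast
qed

text \<open>In the complex coordinate \<open>f = \<psi> / \<delta>\<^sup>m\<close> with \<open>\<delta>\<close> the coordinate of \<open>\<Delta>\<^sub>p\<close>. If \<open>\<eta>\<close> is the extension of
\<open>\<delta>\<^sup>n / \<psi>\<close>, then \<open>\<delta>\<^sup>n / f = \<delta>\<^sup>m \<eta>\<close> is the numerator of \<open>1 / f\<close>.\<close>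

lemma sem_reps_reciprocal_local:
  assumes \<Omega>: "circular \<Omega>" and rep: "(U, f) \<in> sem_reps \<Omega>" and sp: "slice_preserving f U"
    and p: "p \<in> \<Omega>"
    and nz: "\<not> (\<forall>\<^sub>F w in at (qproj p). f (qemb qi w) = 0)"
  obtains N m g where "open N" "circular N" "p \<in> N" "N \<subseteq> \<Omega>"
    "N - qsphere p \<subseteq> {q \<in> U. f q \<noteq> 0}"
    "g \<in> SR N" "\<And>q. q \<in> N - qsphere p \<Longrightarrow> g q = qDelta p q ^ m * inverse (f q)"
proof -
  define z0 where "z0 = qproj p"
  define \<delta> where "\<delta> w = (w - z0) * (w - cnj z0)" for w
  from rep p obtain N m g where N: "open N" "circular N" "p \<in> N" "N \<subseteq> \<Omega>" "N - qsphere p \<subseteq> U"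
    "g \<in> SR N" "\<And>q. q \<in> N - qsphere p \<Longrightarrow> g q = qDelta p q ^ m * f q"
    by (rule sem_reps_local) (rule that)
  have spg: "slice_preserving g N"
    by (rule slice_preserving_numerator[OF \<Omega> rep sp N(6,4,7)])
  define \<psi> where "\<psi> = cstem qRe g"
  have g: "g (qemb I w) = qemb I (\<psi> w)" if "I \<in> qunits" "w \<in> cdom N" for I w
    using slice_preserving_cstem[OF N(6) spg that] by (simp add: \<psi>_def)
  have sph: "qemb I w \<in> N - qsphere p \<longleftrightarrow> w \<in> cdom N - {z0, cnj z0}" if "I \<in> qunits" for I w
    using that N(2) by (auto simp: qemb_mem_iff qemb_mem_qsphere_iff z0_def)
  have fg: "qemb I (\<psi> w) = qemb I (\<delta> w ^ m) * f (qemb I w)"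
    if "I \<in> qunits" "w \<in> cdom N - {z0, cnj z0}" for I w
    using N(7)[of "qemb I w"] g[of I w] that sph[OF that(1), of w]
    by (simp add: qDelta_qemb qemb_power \<delta>_def z0_def)
  have \<delta>: "\<delta> w \<noteq> 0" if "w \<notin> {z0, cnj z0}" for w
    using that by (simp add: \<delta>_def)
  have z0: "z0 \<in> cdom N" using N(2,3) by (simp add: z0_def qproj_mem_iff)
  have evN: "\<forall>\<^sub>F w in at z0. w \<in> cdom N - {z0, cnj z0}"
    using eventually_cdom_punctured[of N z0 p] N(1) z0 sph[OF qi_in_qunits]
    by (simp add: z0_def[symmetric] cdom_def)
  have "\<not> (\<forall>\<^sub>F w in at z0. \<psi> w = 0)"
  proof
    assume "\<forall>\<^sub>F w in at z0. \<psi> w = 0"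
    with evN have "\<forall>\<^sub>F w in at z0. f (qemb qi w) = 0"
    proof eventually_elim
      case (elim w)
      then show ?case using fg[OF qi_in_qunits, of w] \<delta>[of w] by simp
    qed
    with nz show False by (simp add: z0_def)
  qed
  moreover have "\<psi> (cnj z) = cnj (\<psi> z)" for z
    unfolding \<psi>_def by (intro cstem_cnj bounded_linear.linear bounded_linear_quat_components)
  moreover have "\<psi> holomorphic_on cdom N"
    unfolding \<psi>_def by (intro cstem_holomorphic N bounded_linear_quat_components)
  ultimately obtain r n \<eta> where r: "r > 0" "ball z0 r \<union> ball (cnj z0) r \<subseteq> cdom N"
    "\<eta> holomorphic_on ball z0 r \<union> ball (cnj z0) r"
    "\<And>z. z \<in> ball z0 r \<union> ball (cnj z0) r \<Longrightarrow> \<eta> (cnj z) = cnj (\<eta> z)"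
    "\<And>z. z \<in> ball z0 r \<union> ball (cnj z0) r - {z0, cnj z0} \<Longrightarrow> \<psi> z \<noteq> 0 \<and> \<eta> z = \<delta> z ^ n / \<psi> z"
    using reciprocal_extends[of "cdom N" z0 \<psi>] open_cdom[OF N(1)] z0 cnj_mem_cdom[OF N(2)]
    unfolding \<delta>_def by metis
  define W where "W = ball z0 r \<union> ball (cnj z0) r"
  have symW: "cnj z \<in> W \<longleftrightarrow> z \<in> W" for z
    unfolding W_def by (simp add: dist_norm) (metis complex_cnj_cnj complex_cnj_diff complex_mod_cnj)
  have W: "open W" "z0 \<in> W" using r(1) by (auto simp: W_def)
  define M where "M = qproj -` W"
  have M: "open M" "circular M" "p \<in> M"
    using W by (auto simp: M_def z0_def circular_qproj_vimage intro: open_qproj_vimage)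
  have cdom_M: "cdom M = W"
  proof -
    have "qproj (qemb qi z) \<in> W \<longleftrightarrow> z \<in> W" for z
      using qproj_qemb_cases[OF qi_in_qunits, of z] symW[of z] by auto
    then show ?thesis by (auto simp: cdom_def M_def)
  qed
  have MN: "M \<subseteq> N"
  proof
    fix q assume "q \<in> M"
    then have "qproj q \<in> cdom N" using r(2) by (auto simp: M_def W_def)
    then show "q \<in> N" by (simp add: qproj_mem_iff N(2))
  qed
  have \<eta>: "qlift \<eta> \<in> SR M"
    using r(3,4) M by (intro SR_qlift) (auto simp: cdom_M W_def)
  have pt: "f q \<noteq> 0 \<and> qDelta p q ^ m * qlift \<eta> q = qDelta p q ^ n * inverse (f q)"
    if "q \<in> M - qsphere p" for q
  proof -
    obtain I w where I: "I \<in> qunits" "q = qemb I w" by (rule qemb_cases)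
    have w: "w \<in> W - {z0, cnj z0}"
      using that I M(2) by (auto simp: qemb_mem_iff cdom_M qemb_mem_qsphere_iff z0_def)
    then have "w \<in> cdom N - {z0, cnj z0}" using r(2) by (auto simp: W_def)
    note fg = fg[OF I(1) this]
    have \<psi>: "\<psi> w \<noteq> 0" "\<eta> w = \<delta> w ^ n / \<psi> w" using r(5)[of w] w by (simp_all add: W_def)
    have "\<delta> w ^ m \<noteq> 0" using \<delta>[of w] w by simp
    then have "f q = inverse (qemb I (\<delta> w ^ m)) * qemb I (\<psi> w)"
      unfolding fg I(2) using I(1) by (simp flip: mult.assoc)
    then have f: "f q = qemb I (\<psi> w / \<delta> w ^ m)"
      using I(1) by (simp add: divide_inverse mult.commute[of "\<psi> w"] qemb_mult qemb_inverse)
    have \<Delta>: "qDelta p q ^ k = qemb I (\<delta> w ^ k)" for k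
      using I by (simp add: qDelta_qemb qemb_power \<delta>_def z0_def)
    have "qDelta p q ^ m * qlift \<eta> q = qemb I (\<delta> w ^ m * \<eta> w)"
      unfolding \<Delta> using I r(4) w by (subst I(2)) (simp add: qlift_qemb qemb_mult W_def)
    also have "\<delta> w ^ m * \<eta> w = \<delta> w ^ n * inverse (\<psi> w / \<delta> w ^ m)"
      using \<psi> by (simp add: field_simps)
    also have "qemb I \<dots> = qDelta p q ^ n * inverse (f q)"
      unfolding \<Delta> f by (simp only: qemb_mult[OF I(1)] qemb_inverse[OF I(1)])
    finally show ?thesis
      using f I(1) \<psi> \<open>\<delta> w ^ m \<noteq> 0\<close> by simp
  qed
  show thesis
  proof (rule that[of M "\<lambda>q. qDelta p q ^ m * qlift \<eta> q" n])
    show "(\<lambda>q. qDelta p q ^ m * qlift \<eta> q) \<in> SR M"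
      by (intro SR_mult qDelta_power_SR M \<eta>)
    show "M - qsphere p \<subseteq> {q \<in> U. f q \<noteq> 0}"
      using pt MN N(5) by blast
  qed (use M MN N(4) pt in auto)
qed

text \<open>The local construction applies at every point of \<open>\<Omega>\<close> near which \<open>f\<close> does not vanish identically. That
no other points exist is the identity theorem, for which the connectedness of \<open>\<Omega>\<close> is essential: the
points where \<open>f\<close> vanishes in a punctured neighbourhood and those where it is zero-free in one form two
disjoint open sets.\<close>

lemma sem_reps_inverse:
  assumes \<Omega>: "circular_domain \<Omega>" and rep: "(U, f) \<in> sem_reps \<Omega>" and sp: "slice_preserving f U"
    and nz: "q0 \<in> U" "f q0 \<noteq> 0"
  defines "V \<equiv> {q \<in> U. f q \<noteq> 0}"
  shows "(V, \<lambda>q. inverse (f q)) \<in> sem_reps \<Omega>" "slice_preserving (\<lambda>q. inverse (f q)) V"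
proof -
  have circ: "circular \<Omega>" and conn: "connected \<Omega>" using \<Omega> by (auto simp: circular_domain_def)
  note f = sem_repsD(2)[OF rep]
  have U: "open U" "circular U" "U \<subseteq> \<Omega>" using rep f by (auto simp: SR_open SR_circular dest: sem_repsD)
  define \<phi> where "\<phi> = cstem qRe f"
  have \<phi>: "f (qemb I w) = qemb I (\<phi> w)" if "I \<in> qunits" "w \<in> cdom U" for I w
    using slice_preserving_cstem[OF f sp that] by (simp add: \<phi>_def)
  have \<phi>_hol: "\<phi> holomorphic_on cdom U"
    unfolding \<phi>_def by (intro cstem_holomorphic f bounded_linear_quat_components)
  have \<phi>_cnj: "\<phi> (cnj z) = cnj (\<phi> z)" for z
    unfolding \<phi>_def by (intro cstem_cnj bounded_linear.linear bounded_linear_quat_components)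
  define W where "W = {z \<in> cdom U. \<phi> z \<noteq> 0}"
  have symW: "cnj z \<in> W \<longleftrightarrow> z \<in> W" for z
    using U(2) by (simp add: W_def \<phi>_cnj cnj_mem_cdom)
  have mem_V: "qemb I w \<in> V \<longleftrightarrow> w \<in> W" if "I \<in> qunits" for I w
    using that U(2) \<phi>[of I w] by (auto simp: V_def W_def qemb_mem_iff)
  have "V = qproj -` W"
  proof (rule Set.set_eqI)
    fix q obtain I where "I \<in> qunits" "q = qemb I (qproj q)" using qemb_surj by blast
    then show "q \<in> V \<longleftrightarrow> q \<in> qproj -` W" using mem_V by (metis vimage_eq)
  qed
  moreover have "open W"
    using continuous_open_preimage[OF holomorphic_on_imp_continuous_on[OF \<phi>_hol] open_cdom[OF U(1)],
        of "- {0}"]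
    by (simp add: W_def vimage_def Int_def open_Compl)
  ultimately have V: "open V" "circular V"
    by (auto simp: circular_qproj_vimage intro: open_qproj_vimage)
  have cdom_V: "cdom V = W" using mem_V[OF qi_in_qunits] by (auto simp: cdom_def)
  have inv: "inverse (f (qemb I w)) = qemb I (inverse (\<phi> w))" if "I \<in> qunits" "w \<in> W" for I w
    using \<phi>[of I w] that by (simp add: W_def qemb_inverse)
  show "slice_preserving (\<lambda>q. inverse (f q)) V"
    by (auto simp: slice_preserving_iff mem_V inv)
  have "qlift (\<lambda>z. inverse (\<phi> z)) \<in> SR V"
    by (intro SR_qlift V holomorphic_intros) (auto simp: cdom_V W_def \<phi>_cnj intro: holomorphic_on_subset[OF \<phi>_hol])
  then have SR: "(\<lambda>q. inverse (f q)) \<in> SR V"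
  proof (rule SR_cong)
    fix q assume "q \<in> V"
    obtain I w where I: "I \<in> qunits" "q = qemb I w" by (rule qemb_cases)
    with \<open>q \<in> V\<close> have "w \<in> W" using mem_V by simp
    then show "inverse (f q) = qlift (\<lambda>z. inverse (\<phi> z)) q"
      using I by (simp add: inv qlift_qemb \<phi>_cnj)
  qed (use V in auto)

  define Z where "Z = {z. \<forall>\<^sub>F w in at z. f (qemb qi w) = 0}"
  define Z' where "Z' = {z. \<forall>\<^sub>F w in at z. f (qemb qi w) \<noteq> 0}"
  have open_Z: "open (qproj -` Z)" "open (qproj -` Z')"
    unfolding Z_def Z'_def by (intro open_qproj_vimage open_eventually_at)+
  have "z \<notin> Z'" if "z \<in> Z" for z
  proof
    assume "z \<in> Z'"
    with that have "\<forall>\<^sub>F w in at z. False"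
      unfolding Z_def Z'_def mem_Collect_eq by eventually_elim simp
    then show False by simp
  qed
  then have disj: "qproj -` Z \<inter> qproj -` Z' \<inter> \<Omega> = {}" by auto
  have cover: "p \<in> qproj -` Z'" if p: "p \<in> \<Omega>" "p \<notin> qproj -` Z" for p
  proof -
    have "\<not> (\<forall>\<^sub>F w in at (qproj p). f (qemb qi w) = 0)" using p(2) by (simp add: Z_def)
    then obtain N m g where N: "open N" "circular N" "p \<in> N" "N - qsphere p \<subseteq> V"
      by (rule sem_reps_reciprocal_local[OF circ rep sp p(1)]) (auto simp: V_def)
    then have "\<forall>\<^sub>F w in at (qproj p). w \<in> cdom (N - qsphere p)"
      by (intro eventually_cdom_punctured) (auto simp: qproj_mem_iff)
    then have "\<forall>\<^sub>F w in at (qproj p). f (qemb qi w) \<noteq> 0"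
      by eventually_elim (use N(4) in \<open>auto simp: cdom_def V_def\<close>)
    then show ?thesis by (simp add: Z'_def)
  qed
  \<comment> \<open>At a point of the domain where \<open>f\<close> is not zero, continuity excludes vanishing nearby.\<close>
  have "q0 \<notin> qproj -` Z"
  proof
    assume "q0 \<in> qproj -` Z"
    then have ev: "\<forall>\<^sub>F w in at (qproj q0). f (qemb qi w) = (\<lambda>_. 0) (qemb qi w)" by (simp add: Z_def)
    have q0: "qproj q0 \<in> cdom U" using nz(1) U(2) by (simp add: qproj_mem_iff)
    have "f (qemb qi (qproj q0)) = (\<lambda>_. 0) (qemb qi (qproj q0))"
      by (rule SR_eq_extend[OF f SR_const[OF U(1,2), of 0] qi_in_qunits q0 q0 ev])
    then have "\<phi> (qproj q0) = 0" using \<phi>[OF qi_in_qunits q0] by simp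
    moreover obtain I where "I \<in> qunits" "q0 = qemb I (qproj q0)" using qemb_surj by blast
    ultimately show False using \<phi> q0 nz(2) by (metis qemb_0)
  qed
  moreover have "q0 \<in> \<Omega>" using nz U by auto
  ultimately have "qproj -` Z' \<inter> \<Omega> \<noteq> {}" using cover by blast
  then have "qproj -` Z \<inter> \<Omega> = {}"
    using connectedD[OF conn open_Z disj] cover by blast
  then have nZ: "\<not> (\<forall>\<^sub>F w in at (qproj p). f (qemb qi w) = 0)" if "p \<in> \<Omega>" for p
    using that by (auto simp: Z_def)
  show "(V, \<lambda>q. inverse (f q)) \<in> sem_reps \<Omega>"
  proof (rule sem_repsI[OF _ SR])
    show "V \<subseteq> \<Omega>" using U by (auto simp: V_def)
    fix p assume p: "p \<in> \<Omega>"
    from circ rep sp p nZ[OF p] obtain N m g where "open N" "circular N" "p \<in> N" "N \<subseteq> \<Omega>"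
      "N - qsphere p \<subseteq> {q \<in> U. f q \<noteq> 0}" "g \<in> SR N"
      "\<And>q. q \<in> N - qsphere p \<Longrightarrow> g q = qDelta p q ^ m * inverse (f q)"
      by (rule sem_reps_reciprocal_local) (rule that)
    then show "\<exists>N m g. open N \<and> circular N \<and> p \<in> N \<and> N \<subseteq> \<Omega> \<and> N - qsphere p \<subseteq> V \<and>
      g \<in> SR N \<and> (\<forall>q\<in>N - qsphere p. g q = qDelta p q ^ m * inverse (f q))"
      unfolding V_def by (intro exI[of _ N] exI[of _ m] exI[of _ g] conjI ballI)
  qed
qed

section \<open>The field and the module\<close>

lemma SEM_simps:
  "x \<oplus>\<^bsub>SEM \<Omega>\<^esub> y = sem_add \<Omega> x y" "\<zero>\<^bsub>SEM \<Omega>\<^esub> = sem_class \<Omega> \<Omega> (\<lambda>_. 0)"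
  "x \<odot>\<^bsub>SEM \<Omega>\<^esub> y = sem_mult \<Omega> x y"
  by (simp_all add: SEM_def sem_const_class)

lemma SEM_R_simps:
  "x \<oplus>\<^bsub>SEM_R \<Omega>\<^esub> y = sem_add \<Omega> x y" "\<zero>\<^bsub>SEM_R \<Omega>\<^esub> = sem_class \<Omega> \<Omega> (\<lambda>_. 0)"
  "x \<otimes>\<^bsub>SEM_R \<Omega>\<^esub> y = sem_mult \<Omega> x y" "\<one>\<^bsub>SEM_R \<Omega>\<^esub> = sem_class \<Omega> \<Omega> (\<lambda>_. 1)"
  by (simp_all add: SEM_R_def sem_const_class)

lemma circular_domainD:
  assumes "circular_domain \<Omega>"
  shows "open \<Omega>" "circular \<Omega>" "\<Omega> \<noteq> {}"
  using assms by (auto simp: circular_domain_def)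

lemma SEM_cases:
  assumes "A \<in> carrier (SEM \<Omega>)"
  obtains U f where "(U, f) \<in> sem_reps \<Omega>" "A = sem_class \<Omega> U f"
  using assms unfolding carrier_SEM_iff by blast

lemma SEM_R_cases:
  assumes "circular \<Omega>" "A \<in> carrier (SEM_R \<Omega>)"
  obtains U f where "(U, f) \<in> sem_reps \<Omega>" "slice_preserving f U" "A = sem_class \<Omega> U f"
  using assms(2) unfolding carrier_SEM_R_iff[OF assms(1)] by blast

lemma sem_class_in_SEM: "(U, f) \<in> sem_reps \<Omega> \<Longrightarrow> sem_class \<Omega> U f \<in> carrier (SEM \<Omega>)"
  unfolding carrier_SEM_iff by blast

lemma sem_class_in_SEM_R:
  "circular \<Omega> \<Longrightarrow> (U, f) \<in> sem_reps \<Omega> \<Longrightarrow> slice_preserving f U \<Longrightarrow>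
    sem_class \<Omega> U f \<in> carrier (SEM_R \<Omega>)"
  unfolding carrier_SEM_R_iff by blast

lemma slice_preserving_add:
  "slice_preserving f U \<Longrightarrow> slice_preserving g V \<Longrightarrow> slice_preserving (\<lambda>q. f q + g q) (U \<inter> V)"
  by (simp add: slice_preserving_iff slice_add)

lemma slice_preserving_mult:
  "slice_preserving f U \<Longrightarrow> slice_preserving g V \<Longrightarrow> slice_preserving (\<lambda>q. f q * g q) (U \<inter> V)"
  by (simp add: slice_preserving_iff slice_mult)

lemma sem_reps_absorb: "(U, f) \<in> sem_reps \<Omega> \<Longrightarrow> \<Omega> \<inter> U = U" "(U, f) \<in> sem_reps \<Omega> \<Longrightarrow> U \<inter> \<Omega> = U"
  by (auto dest: sem_repsD(1))

text \<open>The negative is obtained as the product with the slice preserving constant \<open>-1\<close>.\<close>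

lemma sem_class_uminus:
  assumes \<Omega>: "open \<Omega>" "circular \<Omega>" and rep: "(U, f) \<in> sem_reps \<Omega>"
  shows "(U, \<lambda>q. - f q) \<in> sem_reps \<Omega>"
    "sem_add \<Omega> (sem_class \<Omega> U (\<lambda>q. - f q)) (sem_class \<Omega> U f) = sem_class \<Omega> \<Omega> (\<lambda>_. 0)"
proof -
  have "slice_preserving (\<lambda>_. -1) \<Omega>" by (rule slice_preserving_const) simp
  from sem_reps_mult[OF \<Omega>(2) sem_reps_const[OF \<Omega>, of "-1"] rep this]
  show r: "(U, \<lambda>q. - f q) \<in> sem_reps \<Omega>" using sem_reps_absorb[OF rep] by simp
  show "sem_add \<Omega> (sem_class \<Omega> U (\<lambda>q. - f q)) (sem_class \<Omega> U f) = sem_class \<Omega> \<Omega> (\<lambda>_. 0)"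
    using sem_reps_add[OF \<Omega>(2) r rep]
    by (simp add: sem_add_class[OF \<Omega>(2) r rep] sem_class_eq_iff sem_reps_const \<Omega>)
qed

lemma SEM_abelian_group:
  assumes "circular_domain \<Omega>"
  shows "abelian_group (SEM \<Omega>)"
proof (rule abelian_groupI)
  note \<Omega> = circular_domainD(1,2)[OF assms]
  note [simp] = SEM_simps sem_add_class \<Omega> sem_reps_add sem_reps_const
  fix A assume "A \<in> carrier (SEM \<Omega>)"
  then obtain U f where A [simp]: "(U, f) \<in> sem_reps \<Omega>" "A = sem_class \<Omega> U f" by (rule SEM_cases)
  show "\<zero>\<^bsub>SEM \<Omega>\<^esub> \<oplus>\<^bsub>SEM \<Omega>\<^esub> A = A" by (simp add: sem_reps_absorb[OF A(1)])
  show "\<exists>B\<in>carrier (SEM \<Omega>). B \<oplus>\<^bsub>SEM \<Omega>\<^esub> A = \<zero>\<^bsub>SEM \<Omega>\<^esub>"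
    using sem_class_uminus[OF \<Omega> A(1)] sem_class_in_SEM by (metis A(2) SEM_simps(1,2))
  fix B assume "B \<in> carrier (SEM \<Omega>)"
  then obtain V g where B [simp]: "(V, g) \<in> sem_reps \<Omega>" "B = sem_class \<Omega> V g" by (rule SEM_cases)
  show "A \<oplus>\<^bsub>SEM \<Omega>\<^esub> B \<in> carrier (SEM \<Omega>)" by (simp add: sem_class_in_SEM)
  show "A \<oplus>\<^bsub>SEM \<Omega>\<^esub> B = B \<oplus>\<^bsub>SEM \<Omega>\<^esub> A" by (simp add: Int_commute add.commute)
  fix C assume "C \<in> carrier (SEM \<Omega>)"
  then obtain W h where C [simp]: "(W, h) \<in> sem_reps \<Omega>" "C = sem_class \<Omega> W h" by (rule SEM_cases)
  show "A \<oplus>\<^bsub>SEM \<Omega>\<^esub> B \<oplus>\<^bsub>SEM \<Omega>\<^esub> C = A \<oplus>\<^bsub>SEM \<Omega>\<^esub> (B \<oplus>\<^bsub>SEM \<Omega>\<^esub> C)"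
    by (simp add: Int_assoc add.assoc)
qed (use circular_domainD[OF assms] in \<open>simp add: SEM_simps sem_class_in_SEM sem_reps_const\<close>)

lemma SEM_R_subset: "carrier (SEM_R \<Omega>) \<subseteq> carrier (SEM \<Omega>)"
  by (auto simp: SEM_R_def SEM_def)

text \<open>Addition and its laws are inherited from \<^term>\<open>SEM \<Omega>\<close>. Multiplication is commutative because at each point
both factors take values in the slice of that point.\<close>

lemma SEM_R_cring:
  assumes "circular_domain \<Omega>"
  shows "cring (SEM_R \<Omega>)"
proof (rule cringI)
  note \<Omega> = circular_domainD(1,2)[OF assms]
  note [simp] = SEM_R_simps sem_add_class sem_mult_class \<Omega> sem_reps_add sem_reps_mult sem_reps_const
    slice_preserving_add slice_preserving_mult slice_preserving_const
  have cases: thesis if "A \<in> carrier (SEM_R \<Omega>)" "\<And>U f. (U, f) \<in> sem_reps \<Omega> \<Longrightarrow>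
      slice_preserving f U \<Longrightarrow> A = sem_class \<Omega> U f \<Longrightarrow> thesis" for A thesis
    using SEM_R_cases[OF \<Omega>(2) that(1)] that(2) by blast
  interpret SEM: abelian_group "SEM \<Omega>" by (rule SEM_abelian_group[OF assms])
  have eq: "A \<oplus>\<^bsub>SEM_R \<Omega>\<^esub> B = A \<oplus>\<^bsub>SEM \<Omega>\<^esub> B" "\<zero>\<^bsub>SEM_R \<Omega>\<^esub> = \<zero>\<^bsub>SEM \<Omega>\<^esub>" for A B
    by (simp_all add: SEM_simps)
  have add: "A \<oplus>\<^bsub>SEM_R \<Omega>\<^esub> B \<in> carrier (SEM_R \<Omega>)"
    if "A \<in> carrier (SEM_R \<Omega>)" "B \<in> carrier (SEM_R \<Omega>)" for A B
    by (rule cases[OF that(1)], rule cases[OF that(2)]) (simp add: sem_class_in_SEM_R)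
  have mult: "A \<otimes>\<^bsub>SEM_R \<Omega>\<^esub> B \<in> carrier (SEM_R \<Omega>)"
    if "A \<in> carrier (SEM_R \<Omega>)" "B \<in> carrier (SEM_R \<Omega>)" for A B
    by (rule cases[OF that(1)], rule cases[OF that(2)]) (simp add: sem_class_in_SEM_R)
  have const: "sem_class \<Omega> \<Omega> (\<lambda>_. c) \<in> carrier (SEM_R \<Omega>)" if "c \<in> \<real>" for c
    using that by (simp add: sem_class_in_SEM_R)
  show "abelian_group (SEM_R \<Omega>)"
  proof (rule abelian_groupI)
    fix A assume A: "A \<in> carrier (SEM_R \<Omega>)"
    show "\<exists>B\<in>carrier (SEM_R \<Omega>). B \<oplus>\<^bsub>SEM_R \<Omega>\<^esub> A = \<zero>\<^bsub>SEM_R \<Omega>\<^esub>"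
    proof (rule cases[OF A])
      fix U f assume f: "(U, f) \<in> sem_reps \<Omega>" "slice_preserving f U" "A = sem_class \<Omega> U f"
      have "slice_preserving (\<lambda>q. - f q) U"
        using f(2) by (simp add: slice_preserving_iff mem_slice_iff)
      then show ?thesis
        using sem_class_uminus[OF \<Omega> f(1)] f(3)
        by (intro bexI[of _ "sem_class \<Omega> U (\<lambda>q. - f q)"]) (auto intro: sem_class_in_SEM_R)
    qed
  qed (use SEM_R_subset[of \<Omega>] add const[of 0] in
      \<open>auto simp del: SEM_R_simps(1,2) simp: eq SEM.a_ac subset_iff
        SEM_R_simps(2)[symmetric]\<close>)
  show "comm_monoid (SEM_R \<Omega>)"
  proof (rule comm_monoidI)
    fix A B assume A: "A \<in> carrier (SEM_R \<Omega>)" and B: "B \<in> carrier (SEM_R \<Omega>)"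
    show "A \<otimes>\<^bsub>SEM_R \<Omega>\<^esub> B = B \<otimes>\<^bsub>SEM_R \<Omega>\<^esub> A"
    proof (rule cases[OF A], rule cases[OF B])
      fix U f V g assume f: "(U, f) \<in> sem_reps \<Omega>" "slice_preserving f U" "A = sem_class \<Omega> U f"
        and g: "(V, g) \<in> sem_reps \<Omega>" "slice_preserving g V" "B = sem_class \<Omega> V g"
      have "f q * g q = g q * f q" if q: "q \<in> U \<inter> V" for q
      proof -
        obtain I where "I \<in> qunits" "q = qemb I (qproj q)" using qemb_surj by blast
        then show ?thesis
          using f(2) g(2) q slice_commute unfolding slice_preserving_iff by (metis Int_iff)
      qed
      then show ?thesis using f g by (simp add: sem_class_eq_iff)
    qed
    fix C assume C: "C \<in> carrier (SEM_R \<Omega>)"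
    show "A \<otimes>\<^bsub>SEM_R \<Omega>\<^esub> B \<otimes>\<^bsub>SEM_R \<Omega>\<^esub> C = A \<otimes>\<^bsub>SEM_R \<Omega>\<^esub> (B \<otimes>\<^bsub>SEM_R \<Omega>\<^esub> C)"
      by (rule cases[OF A], rule cases[OF B], rule cases[OF C]) (simp add: Int_assoc mult.assoc)
  next
    fix A assume A: "A \<in> carrier (SEM_R \<Omega>)"
    show "\<one>\<^bsub>SEM_R \<Omega>\<^esub> \<otimes>\<^bsub>SEM_R \<Omega>\<^esub> A = A"
      by (rule cases[OF A]) (simp add: sem_reps_absorb)
  qed (use mult const[of 1] in simp_all)
  fix A B C assume A: "A \<in> carrier (SEM_R \<Omega>)" and B: "B \<in> carrier (SEM_R \<Omega>)" and C: "C \<in> carrier (SEM_R \<Omega>)"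
  show "(A \<oplus>\<^bsub>SEM_R \<Omega>\<^esub> B) \<otimes>\<^bsub>SEM_R \<Omega>\<^esub> C = A \<otimes>\<^bsub>SEM_R \<Omega>\<^esub> C \<oplus>\<^bsub>SEM_R \<Omega>\<^esub> B \<otimes>\<^bsub>SEM_R \<Omega>\<^esub> C"
  proof (rule cases[OF A], rule cases[OF B], rule cases[OF C])
    fix U f V g W h assume "(U, f) \<in> sem_reps \<Omega>" "slice_preserving f U" "A = sem_class \<Omega> U f"
      "(V, g) \<in> sem_reps \<Omega>" "slice_preserving g V" "B = sem_class \<Omega> V g"
      "(W, h) \<in> sem_reps \<Omega>" "slice_preserving h W" "C = sem_class \<Omega> W h"
    moreover have "U \<inter> V \<inter> W = U \<inter> W \<inter> (V \<inter> W)" by blast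
    ultimately show ?thesis by (simp add: distrib_right)
  qed
qed

lemma SEM_R_field:
  assumes dom: "circular_domain \<Omega>"
  shows "Ring.field (SEM_R \<Omega>)"
proof -
  note \<Omega> = circular_domainD[OF dom]
  interpret cring "SEM_R \<Omega>" by (rule SEM_R_cring[OF dom])
  show ?thesis
  proof (rule cring_fieldI2)
    show "\<zero>\<^bsub>SEM_R \<Omega>\<^esub> \<noteq> \<one>\<^bsub>SEM_R \<Omega>\<^esub>"
      using \<Omega> by (auto simp: SEM_R_simps sem_class_eq_iff sem_reps_const)
    fix A assume A: "A \<in> carrier (SEM_R \<Omega>)" "A \<noteq> \<zero>\<^bsub>SEM_R \<Omega>\<^esub>"
    obtain U f where f: "(U, f) \<in> sem_reps \<Omega>" "slice_preserving f U" "A = sem_class \<Omega> U f"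
      using A(1) by (rule SEM_R_cases[OF \<Omega>(2)])
    then obtain q0 where q0: "q0 \<in> U" "f q0 \<noteq> 0"
      using A(2) \<Omega> by (auto simp: SEM_R_simps sem_class_eq_iff sem_reps_const)
    define V where "V = {q \<in> U. f q \<noteq> 0}"
    note inv = sem_reps_inverse[OF dom f(1,2) q0, folded V_def]
    have "A \<otimes>\<^bsub>SEM_R \<Omega>\<^esub> sem_class \<Omega> V (\<lambda>q. inverse (f q)) =
        sem_class \<Omega> (U \<inter> V) (\<lambda>q. f q * inverse (f q))"
      by (simp add: SEM_R_simps f sem_mult_class \<Omega> inv)
    also have "\<dots> = \<one>\<^bsub>SEM_R \<Omega>\<^esub>"
      using \<Omega> sem_reps_mult[OF \<Omega>(2) f(1) inv(1) f(2)]
      by (simp add: SEM_R_simps sem_class_eq_iff sem_reps_const V_def)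
    finally show "\<exists>B\<in>carrier (SEM_R \<Omega>). A \<otimes>\<^bsub>SEM_R \<Omega>\<^esub> B = \<one>\<^bsub>SEM_R \<Omega>\<^esub>"
      using sem_class_in_SEM_R[OF \<Omega>(2) inv] by blast
  qed
qed

lemma SEM_module:
  assumes "circular_domain \<Omega>"
  shows "Module.module (SEM_R \<Omega>) (SEM \<Omega>)"
proof (rule Module.moduleI)
  note \<Omega> = circular_domainD(1,2)[OF assms]
  show "cring (SEM_R \<Omega>)" by (rule SEM_R_cring[OF assms])
  show "abelian_group (SEM \<Omega>)" by (rule SEM_abelian_group[OF assms])
  note [simp] = SEM_simps SEM_R_simps sem_add_class sem_mult_class \<Omega> sem_reps_add sem_reps_mult
    sem_reps_const slice_preserving_add slice_preserving_mult slice_preserving_const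
  fix X assume "X \<in> carrier (SEM \<Omega>)"
  then obtain W h where X: "(W, h) \<in> sem_reps \<Omega>" "X = sem_class \<Omega> W h" by (rule SEM_cases)
  show "\<one>\<^bsub>SEM_R \<Omega>\<^esub> \<odot>\<^bsub>SEM \<Omega>\<^esub> X = X"
    using X sem_reps_absorb[OF X(1)] by simp
  fix A assume "A \<in> carrier (SEM_R \<Omega>)"
  then obtain U f where A: "(U, f) \<in> sem_reps \<Omega>" "slice_preserving f U" "A = sem_class \<Omega> U f"
    by (rule SEM_R_cases[OF \<Omega>(2)])
  show "A \<odot>\<^bsub>SEM \<Omega>\<^esub> X \<in> carrier (SEM \<Omega>)" using A X by (simp add: sem_class_in_SEM)
  {
    fix B assume "B \<in> carrier (SEM_R \<Omega>)"
    then obtain V g where B: "(V, g) \<in> sem_reps \<Omega>" "slice_preserving g V" "B = sem_class \<Omega> V g"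
      by (rule SEM_R_cases[OF \<Omega>(2)])
    have "U \<inter> V \<inter> W = U \<inter> W \<inter> (V \<inter> W)" by blast
    then show "(A \<oplus>\<^bsub>SEM_R \<Omega>\<^esub> B) \<odot>\<^bsub>SEM \<Omega>\<^esub> X = A \<odot>\<^bsub>SEM \<Omega>\<^esub> X \<oplus>\<^bsub>SEM \<Omega>\<^esub> B \<odot>\<^bsub>SEM \<Omega>\<^esub> X"
      using A B X by (simp add: distrib_right)
    show "A \<otimes>\<^bsub>SEM_R \<Omega>\<^esub> B \<odot>\<^bsub>SEM \<Omega>\<^esub> X = A \<odot>\<^bsub>SEM \<Omega>\<^esub> (B \<odot>\<^bsub>SEM \<Omega>\<^esub> X)"
      using A B X by (simp add: Int_assoc mult.assoc)
  }
  fix Y assume "Y \<in> carrier (SEM \<Omega>)"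
  then obtain V g where Y: "(V, g) \<in> sem_reps \<Omega>" "Y = sem_class \<Omega> V g" by (rule SEM_cases)
  have "U \<inter> (W \<inter> V) = U \<inter> W \<inter> (U \<inter> V)" by blast
  then show "A \<odot>\<^bsub>SEM \<Omega>\<^esub> (X \<oplus>\<^bsub>SEM \<Omega>\<^esub> Y) = A \<odot>\<^bsub>SEM \<Omega>\<^esub> X \<oplus>\<^bsub>SEM \<Omega>\<^esub> A \<odot>\<^bsub>SEM \<Omega>\<^esub> Y"
    using A X Y by (simp add: distrib_left)
qed

lemma power4_module_module:
  assumes "cring R"
  shows "Module.module R (power4_module R)"
proof -
  interpret cring R by fact
  show ?thesis
  proof (rule Module.moduleI[OF assms])
    show "abelian_group (power4_module R)"
    proof (rule abelian_groupI)
      fix v assume "v \<in> carrier (power4_module R)"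
      then show "\<exists>w\<in>carrier (power4_module R). w \<oplus>\<^bsub>power4_module R\<^esub> v = \<zero>\<^bsub>power4_module R\<^esub>"
        by (cases v) (auto simp: power4_module_def l_neg
            intro!: bexI[of _ "(\<ominus>\<^bsub>R\<^esub> fst v, \<ominus>\<^bsub>R\<^esub> fst (snd v), \<ominus>\<^bsub>R\<^esub> fst (snd (snd v)), \<ominus>\<^bsub>R\<^esub> snd (snd (snd v)))"])
    qed (auto simp: power4_module_def a_ac)
  qed (auto simp: power4_module_def l_distr r_distr m_assoc)
qed

section \<open>The abstract isomorphism\<close>

lemma linear_isomorphism_combination:
  fixes R :: "'r ring" and M :: "('r, 'b) module"
  assumes "Module.module R M"
    and E: "\<And>i. i < 4 \<Longrightarrow> E i \<in> carrier M"
    and h: "\<And>a0 a1 a2 a3. a0 \<in> carrier R \<Longrightarrow> a1 \<in> carrier R \<Longrightarrow> a2 \<in> carrier R \<Longrightarrow> a3 \<in> carrier R \<Longrightarrow>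
      h (a0, a1, a2, a3) = a0 \<odot>\<^bsub>M\<^esub> E (0::nat) \<oplus>\<^bsub>M\<^esub> a1 \<odot>\<^bsub>M\<^esub> E 1 \<oplus>\<^bsub>M\<^esub> a2 \<odot>\<^bsub>M\<^esub> E 2 \<oplus>\<^bsub>M\<^esub> a3 \<odot>\<^bsub>M\<^esub> E 3"
    and bij: "bij_betw h (carrier R \<times> carrier R \<times> carrier R \<times> carrier R) (carrier M)"
  shows "linear_isomorphism R (power4_module R) M h"
proof -
  interpret Module.module R M by fact
  note One_nat_def [simp del]
  note [simp] = E[of 0, simplified] E[of 1, simplified] E[of 2, simplified] E[of 3, simplified]
  have add4: "(a \<oplus>\<^bsub>M\<^esub> a') \<oplus>\<^bsub>M\<^esub> (b \<oplus>\<^bsub>M\<^esub> b') \<oplus>\<^bsub>M\<^esub> (c \<oplus>\<^bsub>M\<^esub> c') \<oplus>\<^bsub>M\<^esub> (d \<oplus>\<^bsub>M\<^esub> d') =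
      (a \<oplus>\<^bsub>M\<^esub> b \<oplus>\<^bsub>M\<^esub> c \<oplus>\<^bsub>M\<^esub> d) \<oplus>\<^bsub>M\<^esub> (a' \<oplus>\<^bsub>M\<^esub> b' \<oplus>\<^bsub>M\<^esub> c' \<oplus>\<^bsub>M\<^esub> d')"
    if "a \<in> carrier M" "b \<in> carrier M" "c \<in> carrier M" "d \<in> carrier M"
      "a' \<in> carrier M" "b' \<in> carrier M" "c' \<in> carrier M" "d' \<in> carrier M" for a b c d a' b' c' d'
    using that by (simp add: M.a_ac)
  show ?thesis
    unfolding linear_isomorphism_def
  proof (intro conjI ballI)
    fix v w assume "v \<in> carrier (power4_module R)" "w \<in> carrier (power4_module R)"
    then show "h (v \<oplus>\<^bsub>power4_module R\<^esub> w) = h v \<oplus>\<^bsub>M\<^esub> h w"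
      by (auto simp: power4_module_def h smult_l_distr add4)
  next
    fix r v assume "r \<in> carrier R" "v \<in> carrier (power4_module R)"
    then show "h (r \<odot>\<^bsub>power4_module R\<^esub> v) = r \<odot>\<^bsub>M\<^esub> h v"
      by (auto simp: power4_module_def h smult_r_distr smult_assoc1)
  qed (use assms(1) bij power4_module_module[OF R.is_cring] in \<open>simp_all add: power4_module_def\<close>)
qed

text \<open>Bijectivity of \<open>(a\<^sub>0, \<dots>, a\<^sub>3) \<mapsto> \<Sum> a\<^sub>i E\<^sub>i\<close> says that the \<open>E\<^sub>i\<close> form a basis. As a basis is a set
here, the \<open>E\<^sub>i\<close> have to be distinct for it to have four elements.\<close>

lemma module_basis_of_combination:
  fixes R :: "'r ring" and M :: "('r, 'b) module"
  assumes "Module.module R M"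
    and E: "\<And>i. i < 4 \<Longrightarrow> E i \<in> carrier M" and inj: "inj_on E {..<4::nat}"
    and h: "\<And>a0 a1 a2 a3. a0 \<in> carrier R \<Longrightarrow> a1 \<in> carrier R \<Longrightarrow> a2 \<in> carrier R \<Longrightarrow> a3 \<in> carrier R \<Longrightarrow>
      h (a0, a1, a2, a3) = a0 \<odot>\<^bsub>M\<^esub> E (0::nat) \<oplus>\<^bsub>M\<^esub> a1 \<odot>\<^bsub>M\<^esub> E 1 \<oplus>\<^bsub>M\<^esub> a2 \<odot>\<^bsub>M\<^esub> E 2 \<oplus>\<^bsub>M\<^esub> a3 \<odot>\<^bsub>M\<^esub> E 3"
    and bij: "bij_betw h (carrier R \<times> carrier R \<times> carrier R \<times> carrier R) (carrier M)"
  shows "module_basis R M (E ` {..<4})" "card (E ` {..<4}) = 4"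
proof -
  interpret Module.module R M by fact
  note One_nat_def [simp del]
  note E' [simp] = E[of 0, simplified] E[of 1, simplified] E[of 2, simplified] E[of 3, simplified]
  have set: "{..<4::nat} = {0, 1, 2, 3}" by auto
  have EB: "E ` {..<4} = {E 0, E 1, E 2, E 3}" unfolding set by simp
  have dist: "E 0 \<noteq> E 1" "E 0 \<noteq> E 2" "E 0 \<noteq> E 3" "E 1 \<noteq> E 2" "E 1 \<noteq> E 3" "E 2 \<noteq> E 3"
    using inj unfolding set by (auto simp: inj_on_def)
  show "card (E ` {..<4}) = 4" using card_image[OF inj] by simp
  have sum: "(\<Oplus>\<^bsub>M\<^esub>b\<in>E ` {..<4}. c b \<odot>\<^bsub>M\<^esub> b) = h (c (E 0), c (E 1), c (E 2), c (E 3))"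
    if c: "c \<in> E ` {..<4} \<rightarrow> carrier R" for c
  proof -
    have [simp]: "c (E 0) \<in> carrier R" "c (E 1) \<in> carrier R" "c (E 2) \<in> carrier R" "c (E 3) \<in> carrier R"
      using c unfolding EB by auto
    show ?thesis unfolding EB using dist by (simp add: h M.a_ac Pi_def)
  qed
  show "module_basis R M (E ` {..<4})"
    unfolding module_basis_def
  proof (intro conjI ballI impI)
    fix c b assume c: "c \<in> E ` {..<4} \<rightarrow> carrier R" and b: "b \<in> E ` {..<4}"
      and "(\<Oplus>\<^bsub>M\<^esub>b\<in>E ` {..<4}. c b \<odot>\<^bsub>M\<^esub> b) = \<zero>\<^bsub>M\<^esub>"
    then have "h (c (E 0), c (E 1), c (E 2), c (E 3)) = h (\<zero>\<^bsub>R\<^esub>, \<zero>\<^bsub>R\<^esub>, \<zero>\<^bsub>R\<^esub>, \<zero>\<^bsub>R\<^esub>)"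
      using sum by (simp add: h)
    moreover have "c (E 0) \<in> carrier R" "c (E 1) \<in> carrier R" "c (E 2) \<in> carrier R" "c (E 3) \<in> carrier R"
      using c unfolding EB by auto
    ultimately have "(c (E 0), c (E 1), c (E 2), c (E 3)) = (\<zero>\<^bsub>R\<^esub>, \<zero>\<^bsub>R\<^esub>, \<zero>\<^bsub>R\<^esub>, \<zero>\<^bsub>R\<^esub>)"
      by (intro inj_onD[OF bij_betw_imp_inj_on[OF bij]]) auto
    then show "c b = \<zero>\<^bsub>R\<^esub>" using b unfolding EB by auto
  next
    fix v assume "v \<in> carrier M"
    then have "v \<in> h ` (carrier R \<times> carrier R \<times> carrier R \<times> carrier R)"
      using bij by (simp add: bij_betw_def)
    then obtain a0 a1 a2 a3 where a: "a0 \<in> carrier R" "a1 \<in> carrier R" "a2 \<in> carrier R" "a3 \<in> carrier R"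
      "v = h (a0, a1, a2, a3)" by auto
    \<comment> \<open>Coefficients are indexed by the basis vectors themselves.\<close>
    define c where "c b = (if b = E 0 then a0 else if b = E 1 then a1 else if b = E 2 then a2 else a3)" for b
    have "c \<in> E ` {..<4} \<rightarrow> carrier R" using a by (auto simp: c_def)
    moreover have "v = (\<Oplus>\<^bsub>M\<^esub>b\<in>E ` {..<4}. c b \<odot>\<^bsub>M\<^esub> b)"
      unfolding sum[OF calculation] a(5) using dist by (simp add: c_def)
    ultimately show "\<exists>c\<in>E ` {..<4} \<rightarrow> carrier R. v = (\<Oplus>\<^bsub>M\<^esub>b\<in>E ` {..<4}. c b \<odot>\<^bsub>M\<^esub> b)" by blast
  qed (use E in auto)
qed

section \<open>Components with respect to a real basis\<close>

lemma quat_linear_imp_bounded_linear: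
  fixes l :: "quat \<Rightarrow> real"
  assumes "linear l"
  shows "bounded_linear l"
proof -
  have "l q = qRe q * l (Quat 1 0 0 0) + qIm1 q * l (Quat 0 1 0 0)
      + qIm2 q * l (Quat 0 0 1 0) + qIm3 q * l (Quat 0 0 0 1)" for q
  proof -
    have "q = qRe q *\<^sub>R Quat 1 0 0 0 + qIm1 q *\<^sub>R Quat 0 1 0 0
        + qIm2 q *\<^sub>R Quat 0 0 1 0 + qIm3 q *\<^sub>R Quat 0 0 0 1"
      by (simp add: quat_eq_iff plus_quat_def scaleR_quat_def)
    then have "l q = l (qRe q *\<^sub>R Quat 1 0 0 0 + qIm1 q *\<^sub>R Quat 0 1 0 0
        + qIm2 q *\<^sub>R Quat 0 0 1 0 + qIm3 q *\<^sub>R Quat 0 0 0 1)" by simp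
    then show ?thesis using assms by (simp add: linear_add linear_scale)
  qed
  then show ?thesis
    by (subst ext) (assumption, intro bounded_linear_add bounded_linear_quat_components
        bounded_linear_mult_const)
qed

lemma sum_lessThan_4: "(\<Sum>k<4. g k) = g 0 + g 1 + g 2 + g (3::nat)"
  by (simp add: eval_nat_numeral)

lemma quat_basis_coordinates:
  fixes e :: "nat \<Rightarrow> quat"
  assumes inj: "inj_on e {..<4}" and ind: "independent (e ` {..<4})" and span: "span (e ` {..<4}) = UNIV"
  obtains l :: "nat \<Rightarrow> quat \<Rightarrow> real" where "\<And>k. bounded_linear (l k)"
    "\<And>v. (\<Sum>k<4. l k v *\<^sub>R e k) = v"
    "\<And>j k. j < 4 \<Longrightarrow> k < 4 \<Longrightarrow> l j (e k) = (if j = k then 1 else 0)"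
proof
  define B where "B = e ` {..<4}"
  define l where "l k v = representation B v (e k)" for k v
  have B: "independent B" "v \<in> span B" "finite B" for v
    using ind span by (simp_all add: B_def)
  show "bounded_linear (l k)" for k
    unfolding l_def by (intro quat_linear_imp_bounded_linear linearI)
      (simp_all add: real_vector.representation_add real_vector.representation_scale B)
  show "(\<Sum>k<4. l k v *\<^sub>R e k) = v" for v
  proof -
    have "(\<Sum>k<4. l k v *\<^sub>R e k) = (\<Sum>b\<in>B. representation B v b *\<^sub>R b)"
      unfolding l_def B_def by (simp add: sum.reindex[OF inj])
    also have "\<dots> = v" by (rule real_vector.sum_representation_eq) (use B in auto)
    finally show ?thesis .
  qed
  show "l j (e k) = (if j = k then 1 else 0)" if "j < 4" "k < 4" for j k
  proof -
    have "e k \<in> B" using that by (simp add: B_def)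
    then show ?thesis
      using that inj_onD[OF inj, of j k]
      by (auto simp: l_def real_vector.representation_basis[OF B(1)])
  qed
qed

definition qcomp :: "(quat \<Rightarrow> real) \<Rightarrow> (quat \<Rightarrow> quat) \<Rightarrow> quat \<Rightarrow> quat" where
  "qcomp l f = qlift (cstem l f)"

lemma qcomp_qemb: "bounded_linear l \<Longrightarrow> I \<in> qunits \<Longrightarrow> qcomp l f (qemb I z) = qemb I (cstem l f z)"
  unfolding qcomp_def by (intro qlift_qemb cstem_cnj bounded_linear.linear)

lemma qcomp_SR:
  assumes f: "f \<in> SR U" and l: "bounded_linear l"
  shows "qcomp l f \<in> SR U" "slice_preserving (qcomp l f) U"
  unfolding qcomp_def
  by (intro SR_qlift SR_open[OF f] SR_circular[OF f] cstem_holomorphic[OF f l] cstem_cnj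
      bounded_linear.linear[OF l])+

lemma cstem_cong:
  assumes "circular U" "z \<in> cdom U" "\<And>q. q \<in> U \<Longrightarrow> f q = g q"
  shows "cstem l f z = cstem l g z"
proof -
  have "qemb qi z \<in> U" "qemb qi (cnj z) \<in> U"
    using assms(1,2) by (simp_all add: qemb_mem_iff cnj_mem_cdom)
  then show ?thesis by (simp add: cstem_def stem1_def stem2_def assms(3))
qed

text \<open>Passing to a component commutes with multiplication by a slice preserving function, whose stem
is real.\<close>

lemma cstem_mult:
  assumes f: "f \<in> SR U" "slice_preserving f U" and g: "g \<in> SR U" and l: "linear l" and z: "z \<in> cdom U"
  shows "cstem l (\<lambda>q. f q * g q) z = cstem qRe f z * cstem l g z"
proof -
  define \<phi> where "\<phi> = cstem qRe f"
  have U: "circular U" using g by (rule SR_circular)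
  have \<phi>: "\<phi> (cnj z) = cnj (\<phi> z)" for z
    unfolding \<phi>_def by (intro cstem_cnj bounded_linear.linear bounded_linear_quat_components)
  have fg: "f (qemb I z) * g (qemb I z) =
      (Re (\<phi> z) *\<^sub>R stem1 g z - Im (\<phi> z) *\<^sub>R stem2 g z)
      + I * (Re (\<phi> z) *\<^sub>R stem2 g z + Im (\<phi> z) *\<^sub>R stem1 g z)"
    if I: "I \<in> qunits" and "qemb I z \<in> U" for I z
  proof -
    have z: "z \<in> cdom U" using that U by (simp add: qemb_mem_iff)
    show ?thesis
      unfolding \<phi>_def by (rule slice_preserving_mult_stem[OF f g I z])
  qed
  have "stem1 (\<lambda>q. f q * g q) z = Re (\<phi> z) *\<^sub>R stem1 g z - Im (\<phi> z) *\<^sub>R stem2 g z"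
    "stem2 (\<lambda>q. f q * g q) z = Re (\<phi> z) *\<^sub>R stem2 g z + Im (\<phi> z) *\<^sub>R stem1 g z"
    using stem_unique[OF U z, of "\<lambda>q. f q * g q"
        "\<lambda>z. Re (\<phi> z) *\<^sub>R stem1 g z - Im (\<phi> z) *\<^sub>R stem2 g z"
        "\<lambda>z. Re (\<phi> z) *\<^sub>R stem2 g z + Im (\<phi> z) *\<^sub>R stem1 g z"] fg
    by (simp_all add: \<phi>)
  then show ?thesis
    using l by (simp add: cstem_def[of l] linear_add linear_diff linear_scale complex_eq_iff
        flip: \<phi>_def) 
qed

text \<open>If \<open>g\<close> extends \<open>\<Delta>\<^sub>p\<^sup>m f\<close>, then the component of \<open>g\<close> extends \<open>\<Delta>\<^sub>p\<^sup>m\<close> times the component of \<open>f\<close>.\<close>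

lemma sem_reps_qcomp:
  assumes \<Omega>: "circular \<Omega>" and rep: "(U, f) \<in> sem_reps \<Omega>" and l: "bounded_linear l"
  shows "(U, qcomp l f) \<in> sem_reps \<Omega>"
proof (rule sem_repsI)
  note f = sem_repsD(2)[OF rep]
  show "U \<subseteq> \<Omega>" using rep by (rule sem_repsD)
  show "qcomp l f \<in> SR U" by (rule qcomp_SR[OF f l])
  fix p assume "p \<in> \<Omega>"
  with rep obtain N m g where N: "open N" "circular N" "p \<in> N" "N \<subseteq> \<Omega>" "N - qsphere p \<subseteq> U"
    "g \<in> SR N" "\<And>q. q \<in> N - qsphere p \<Longrightarrow> g q = qDelta p q ^ m * f q"
    by (rule sem_reps_local) (rule that)
  define N0 where "N0 = N - qsphere p"
  have N0: "open N0" "circular N0" "N0 \<subseteq> U"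
    using N by (auto simp: N0_def open_qsphere_Diff circular_Diff_sphere)
  have "qcomp l g q = qDelta p q ^ m * qcomp l f q" if "q \<in> N0" for q
  proof -
    obtain I z where I: "I \<in> qunits" "q = qemb I z" by (rule qemb_cases)
    then have z: "z \<in> cdom N0" using that N0(2) by (simp add: qemb_mem_iff)
    have "cstem l g z = cstem l (\<lambda>q. qDelta p q ^ m * f q) z"
      by (rule cstem_cong[OF N0(2) z]) (simp add: N(7) N0_def)
    also have "\<dots> = cstem qRe (\<lambda>q. qDelta p q ^ m) z * cstem l f z"
      by (intro cstem_mult[OF _ _ _ _ z] qDelta_power_SR N0 bounded_linear.linear[OF l] SR_subset[OF f])
    finally have "qcomp l g q = qemb I (cstem qRe (\<lambda>q. qDelta p q ^ m) z) * qcomp l f q"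
      using I l by (simp add: qcomp_qemb qemb_mult)
    also have "qemb I (cstem qRe (\<lambda>q. qDelta p q ^ m) z) = qDelta p q ^ m"
      unfolding I(2) by (rule slice_preserving_cstem[OF qDelta_power_SR[OF N0(1,2)] I(1) z, symmetric])
    finally show ?thesis .
  qed
  then show "\<exists>N m g. open N \<and> circular N \<and> p \<in> N \<and> N \<subseteq> \<Omega> \<and> N - qsphere p \<subseteq> U \<and>
      g \<in> SR N \<and> (\<forall>q\<in>N - qsphere p. g q = qDelta p q ^ m * qcomp l f q)"
    using N(1-5) qcomp_SR(1)[OF N(6) l] unfolding N0_def
    by (intro exI[of _ N] exI[of _ m] exI[of _ "qcomp l g"]) simp
qed

text \<open>Existence of the decomposition: expand both parts of the stem in the basis. The basis vectors stand on
the right and therefore do not interfere with the unit \<open>I\<close> on the left.\<close>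

lemma qcomp_expansion:
  fixes e :: "nat \<Rightarrow> quat"
  assumes f: "f \<in> SR U" and l: "\<And>k. bounded_linear (l k)" "\<And>v. (\<Sum>k<4. l k v *\<^sub>R e k) = v"
    and q: "q \<in> U"
  shows "(\<Sum>k<(4::nat). qcomp (l k) f q * e k) = f q"
proof -
  obtain I z where I: "I \<in> qunits" "q = qemb I z" by (rule qemb_cases)
  then have z: "z \<in> cdom U" using q SR_circular[OF f] by (simp add: qemb_mem_iff)
  have "(\<Sum>k<4. qcomp (l k) f q * e k)
      = (\<Sum>k<4. l k (stem1 f z) *\<^sub>R e k) + I * (\<Sum>k<4. l k (stem2 f z) *\<^sub>R e k)"
    unfolding I(2) qcomp_qemb[OF l(1) I(1)]
    by (simp add: qemb_eq cstem_def of_real_def distrib_right sum.distrib sum_distrib_left)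
  then show ?thesis unfolding l(2) I(2) by (simp add: SR_stem[OF f I(1) z])
qed

text \<open>Uniqueness of the decomposition: the stem of the combination is the combination of the real stems of
the \<open>f k\<close>, and the coordinate \<open>l\<close> dual to \<open>e j\<close> picks the \<open>j\<close>-th one.\<close>

lemma cstem_combination:
  fixes e :: "nat \<Rightarrow> quat"
  assumes f: "\<And>k. k < 4 \<Longrightarrow> f k \<in> SR U" "\<And>k. k < 4 \<Longrightarrow> slice_preserving (f k) U"
    and l: "linear l" "\<And>k. k < 4 \<Longrightarrow> l (e k) = (if j = k then 1 else 0)"
    and j: "j < 4" and z: "z \<in> cdom U"
  shows "cstem l (\<lambda>q. \<Sum>k<4. f k q * e k) z = cstem qRe (f j) z"
proof -
  define \<phi> where "\<phi> k = cstem qRe (f k)" for k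
  have U: "circular U" using f(1)[OF j] by (rule SR_circular)
  have \<phi>: "\<phi> k (cnj z) = cnj (\<phi> k z)" for k z
    unfolding \<phi>_def by (intro cstem_cnj bounded_linear.linear bounded_linear_quat_components)
  have F: "(\<Sum>k<4. f k (qemb I w) * e k)
      = (\<Sum>k<4. Re (\<phi> k w) *\<^sub>R e k) + I * (\<Sum>k<4. Im (\<phi> k w) *\<^sub>R e k)"
    if I: "I \<in> qunits" and "qemb I w \<in> U" for I w
  proof -
    have w: "w \<in> cdom U" using that U by (simp add: qemb_mem_iff)
    have "f k (qemb I w) * e k = Re (\<phi> k w) *\<^sub>R e k + I * (Im (\<phi> k w) *\<^sub>R e k)" if "k < 4" for k
      unfolding slice_preserving_cstem[OF f(1)[OF that] f(2)[OF that] I w] \<phi>_def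
      by (simp add: qemb_eq of_real_def distrib_right)
    then show ?thesis by (simp add: sum.distrib sum_distrib_left)
  qed
  have "stem1 (\<lambda>q. \<Sum>k<4. f k q * e k) z = (\<Sum>k<4. Re (\<phi> k z) *\<^sub>R e k)"
    "stem2 (\<lambda>q. \<Sum>k<4. f k q * e k) z = (\<Sum>k<4. Im (\<phi> k z) *\<^sub>R e k)"
    using stem_unique[OF U z, of "\<lambda>q. \<Sum>k<4. f k q * e k" "\<lambda>w. \<Sum>k<4. Re (\<phi> k w) *\<^sub>R e k"
        "\<lambda>w. \<Sum>k<4. Im (\<phi> k w) *\<^sub>R e k"] F
    by (simp_all add: \<phi> sum_negf)
  moreover have "l (\<Sum>k<4. c k *\<^sub>R e k) = c j" for c
  proof -
    have "l (\<Sum>k<4. c k *\<^sub>R e k) = (\<Sum>k<4. c k * l (e k))"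
      using l(1) by (simp add: linear_sum linear_scale)
    also have "\<dots> = (\<Sum>k<4. if j = k then c k else 0)"
      by (intro sum.cong refl) (simp add: l(2))
    finally show ?thesis using j by simp
  qed
  ultimately show ?thesis by (simp add: cstem_def[of l] \<phi>_def)
qed

section \<open>The combination map\<close>

definition sem_combination :: "quat set \<Rightarrow> (nat \<Rightarrow> quat) \<Rightarrow> (nat \<Rightarrow> sem) \<Rightarrow> sem" where
  "sem_combination \<Omega> e A =
     A 0 \<odot>\<^bsub>SEM \<Omega>\<^esub> sem_const \<Omega> (e 0) \<oplus>\<^bsub>SEM \<Omega>\<^esub> A 1 \<odot>\<^bsub>SEM \<Omega>\<^esub> sem_const \<Omega> (e 1)
       \<oplus>\<^bsub>SEM \<Omega>\<^esub> A 2 \<odot>\<^bsub>SEM \<Omega>\<^esub> sem_const \<Omega> (e 2) \<oplus>\<^bsub>SEM \<Omega>\<^esub> A 3 \<odot>\<^bsub>SEM \<Omega>\<^esub> sem_const \<Omega> (e 3)"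

lemma sem_combination_class:
  assumes \<Omega>: "open \<Omega>" "circular \<Omega>"
    and f: "\<And>k. k < 4 \<Longrightarrow> (U k, f k) \<in> sem_reps \<Omega>" "\<And>k. k < 4 \<Longrightarrow> slice_preserving (f k) (U k)"
    and A: "\<And>k. k < 4 \<Longrightarrow> A k = sem_class \<Omega> (U k) (f k)"
  shows "((\<Inter>k<4. U k), \<lambda>q. \<Sum>k<4. f k q * e k) \<in> sem_reps \<Omega>"
    and "sem_combination \<Omega> e A = sem_class \<Omega> (\<Inter>k<4. U k) (\<lambda>q. \<Sum>k<4. f k q * e k)"
proof -
  have W: "(\<Inter>k<4. U k) = U 0 \<inter> U 1 \<inter> U 2 \<inter> U 3"
    by (auto simp: eval_nat_numeral less_Suc_eq)
  have m: "(U k, \<lambda>q. f k q * e k) \<in> sem_reps \<Omega>"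
    "A k \<odot>\<^bsub>SEM \<Omega>\<^esub> sem_const \<Omega> (e k) = sem_class \<Omega> (U k) (\<lambda>q. f k q * e k)" if "k < 4" for k
    using sem_reps_mult[OF \<Omega>(2) f(1)[OF that] sem_reps_const[OF \<Omega>, of "e k"] f(2)[OF that]]
      sem_mult_class[OF \<Omega>(2) f(1)[OF that] sem_reps_const[OF \<Omega>, of "e k"] f(2)[OF that]]
    by (simp_all add: SEM_simps sem_const_class A that sem_reps_absorb[OF f(1)[OF that]])
  note m' = m(1)[of 0, simplified] m(1)[of 1, simplified] m(1)[of 2, simplified] m(1)[of 3, simplified]
  note s1 = sem_reps_add[OF \<Omega>(2) m'(1,2)]
  note s2 = sem_reps_add[OF \<Omega>(2) s1 m'(3)]
  note s3 = sem_reps_add[OF \<Omega>(2) s2 m'(4)]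
  show "((\<Inter>k<4. U k), \<lambda>q. \<Sum>k<4. f k q * e k) \<in> sem_reps \<Omega>"
    using s3 by (simp add: W sum_lessThan_4)
  show "sem_combination \<Omega> e A = sem_class \<Omega> (\<Inter>k<4. U k) (\<lambda>q. \<Sum>k<4. f k q * e k)"
    using sem_add_class[OF \<Omega>(2) m'(1,2)] sem_add_class[OF \<Omega>(2) s1 m'(3)]
      sem_add_class[OF \<Omega>(2) s2 m'(4)]
    by (simp add: sem_combination_def m W sum_lessThan_4 SEM_simps(1))
qed

lemma SEM_R_family_cases:
  fixes B :: "nat \<Rightarrow> sem"
  assumes \<Omega>: "circular \<Omega>" and B: "\<And>k. k < n \<Longrightarrow> B k \<in> carrier (SEM_R \<Omega>)"
  obtains U f where "\<And>k. k < n \<Longrightarrow> (U k, f k) \<in> sem_reps \<Omega>"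
    "\<And>k. k < n \<Longrightarrow> slice_preserving (f k) (U k)" "\<And>k. k < n \<Longrightarrow> B k = sem_class \<Omega> (U k) (f k)"
proof -
  from B have "\<forall>k. \<exists>p. k < n \<longrightarrow> (fst p, snd p) \<in> sem_reps \<Omega> \<and> slice_preserving (snd p) (fst p) \<and>
      B k = sem_class \<Omega> (fst p) (snd p)"
    unfolding carrier_SEM_R_iff[OF \<Omega>] by (metis fst_conv snd_conv)
  from choice[OF this] obtain p where p: "\<And>k. k < n \<Longrightarrow> (fst (p k), snd (p k)) \<in> sem_reps \<Omega> \<and>
      slice_preserving (snd (p k)) (fst (p k)) \<and> B k = sem_class \<Omega> (fst (p k)) (snd (p k))"
    by blast
  show thesis
    by (rule that[of "\<lambda>k. fst (p k)" "\<lambda>k. snd (p k)"]) (use p in blast)+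
qed

text \<open>Equal combinations agree only where all eight representatives are defined. There their components agree,
and this determines the classes because that set is the domain of a representative, hence dense.\<close>

lemma sem_combination_inj:
  fixes l :: "nat \<Rightarrow> quat \<Rightarrow> real"
  assumes \<Omega>: "open \<Omega>" "circular \<Omega>"
    and l: "\<And>k. bounded_linear (l k)"
      "\<And>j k. j < 4 \<Longrightarrow> k < 4 \<Longrightarrow> l j (e k) = (if j = k then 1 else 0)"
    and A: "\<And>k. k < 4 \<Longrightarrow> A k \<in> carrier (SEM_R \<Omega>)" "\<And>k. k < 4 \<Longrightarrow> A' k \<in> carrier (SEM_R \<Omega>)"
    and eq: "sem_combination \<Omega> e A = sem_combination \<Omega> e A'" and j: "j < (4::nat)"
  shows "A j = A' j"
proof -
  obtain U f where
    f: "\<And>k. k < 4 \<Longrightarrow> (U k, f k) \<in> sem_reps \<Omega>" "\<And>k. k < 4 \<Longrightarrow> slice_preserving (f k) (U k)"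
      "\<And>k. k < 4 \<Longrightarrow> A k = sem_class \<Omega> (U k) (f k)"
    using SEM_R_family_cases[of \<Omega> 4 A, OF \<Omega>(2) A(1)] by blast
  obtain U' f' where
    f': "\<And>k. k < 4 \<Longrightarrow> (U' k, f' k) \<in> sem_reps \<Omega>" "\<And>k. k < 4 \<Longrightarrow> slice_preserving (f' k) (U' k)"
      "\<And>k. k < 4 \<Longrightarrow> A' k = sem_class \<Omega> (U' k) (f' k)"
    using SEM_R_family_cases[of \<Omega> 4 A', OF \<Omega>(2) A(2)] by blast
  define F F' where "F q = (\<Sum>k<4. f k q * e k)" and "F' q = (\<Sum>k<4. f' k q * e k)" for q
  define W where "W = (\<Inter>k<4. U k) \<inter> (\<Inter>k<4. U' k)"
  have F: "((\<Inter>k<4. U k), F) \<in> sem_reps \<Omega>" "sem_combination \<Omega> e A = sem_class \<Omega> (\<Inter>k<4. U k) F"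
    using sem_combination_class[OF \<Omega>, of U f A e] f unfolding F_def by simp_all
  have F': "((\<Inter>k<4. U' k), F') \<in> sem_reps \<Omega>" "sem_combination \<Omega> e A' = sem_class \<Omega> (\<Inter>k<4. U' k) F'"
    using sem_combination_class[OF \<Omega>, of U' f' A' e] f' unfolding F'_def by simp_all
  have FF': "F q = F' q" if "q \<in> W" for q
    using eq that unfolding F(2) F'(2) sem_class_eq_iff[OF \<Omega>(2) F(1) F'(1)] W_def by blast
  have W: "(W, \<lambda>q. F q + F' q) \<in> sem_reps \<Omega>"
    unfolding W_def by (rule sem_reps_add[OF \<Omega>(2) F(1) F'(1)])
  then have oW: "open W" "circular W" by (auto dest: sem_repsD(2) SR_open SR_circular)
  have WU: "W \<subseteq> U k" "W \<subseteq> U' k" if "k < 4" for k using that by (auto simp: W_def)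
  have fk: "f k \<in> SR W" "slice_preserving (f k) W" "f' k \<in> SR W" "slice_preserving (f' k) W" if "k < 4" for k
    using SR_subset[OF sem_repsD(2)[OF f(1)[OF that]] oW WU(1)[OF that]]
      SR_subset[OF sem_repsD(2)[OF f'(1)[OF that]] oW WU(2)[OF that]]
      f(2)[OF that] f'(2)[OF that] WU[OF that]
    unfolding slice_preserving_iff by blast+
  have "f j q = f' j q" if q: "q \<in> W" for q
  proof -
    obtain I z where I: "I \<in> qunits" "q = qemb I z" by (rule qemb_cases)
    then have z: "z \<in> cdom W" using q oW by (simp add: qemb_mem_iff)
    have "cstem qRe (f j) z = cstem (l j) F z"
      unfolding F_def
      by (rule cstem_combination[OF fk(1,2) bounded_linear.linear[OF l(1)] l(2)[OF j] j z, symmetric])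
    also have "\<dots> = cstem (l j) F' z"
      by (rule cstem_cong[OF oW(2) z FF'])
    also have "\<dots> = cstem qRe (f' j) z"
      unfolding F'_def
      by (rule cstem_combination[OF fk(3,4) bounded_linear.linear[OF l(1)] l(2)[OF j] j z])
    finally show ?thesis
      unfolding I(2) slice_preserving_cstem[OF fk(1)[OF j] fk(2)[OF j] I(1) z]
        slice_preserving_cstem[OF fk(3)[OF j] fk(4)[OF j] I(1) z] by simp
  qed
  then have "\<forall>q\<in>U j \<inter> U' j. f j q = f' j q"
    using sem_reps_eq_dense[OF \<Omega>(2) f(1)[OF j] f'(1)[OF j] W] by blast
  then show ?thesis
    unfolding f(3)[OF j] f'(3)[OF j] sem_class_eq_iff[OF \<Omega>(2) f(1)[OF j] f'(1)[OF j]] .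
qed

lemma sem_combination_surj:
  assumes \<Omega>: "open \<Omega>" "circular \<Omega>"
    and l: "\<And>k. bounded_linear (l k)" "\<And>v. (\<Sum>k<4. l k v *\<^sub>R e k) = v"
    and B: "B \<in> carrier (SEM \<Omega>)"
  obtains A where "\<And>k. A k \<in> carrier (SEM_R \<Omega>)" "sem_combination \<Omega> e A = B"
proof -
  obtain U f where f: "(U, f) \<in> sem_reps \<Omega>" "B = sem_class \<Omega> U f" using B by (rule SEM_cases)
  have c: "(U, qcomp (l k) f) \<in> sem_reps \<Omega>" "slice_preserving (qcomp (l k) f) U" for k
    using sem_reps_qcomp[OF \<Omega>(2) f(1) l(1)] qcomp_SR(2)[OF sem_repsD(2)[OF f(1)] l(1)] by auto
  define A where "A k = sem_class \<Omega> U (qcomp (l k) f)" for k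
  have "0 \<in> {..<4::nat}" by simp
  then have U: "(\<Inter>k<4::nat. U) = U" by blast
  note comb = sem_combination_class[OF \<Omega>, of "\<lambda>_. U" "\<lambda>k. qcomp (l k) f" A e, OF c A_def, unfolded U]
  have "sem_combination \<Omega> e A = B"
    unfolding comb(2) f(2) sem_class_eq_iff[OF \<Omega>(2) comb(1) f(1)]
    using qcomp_expansion[OF sem_repsD(2)[OF f(1)] l] by simp
  moreover have "A k \<in> carrier (SEM_R \<Omega>)" for k
    unfolding A_def by (rule sem_class_in_SEM_R[OF \<Omega>(2) c])
  ultimately show thesis using that by blast
qed

theorem proposition2p10:
  fixes \<Omega> :: "quat set" and I J K :: quat
  assumes "circular_domain \<Omega>"
    and "distinct [1, I, J, K]"
    and "independent {1, I, J, K}"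
    and "span {1, I, J, K} = UNIV"
  shows "linear_isomorphism (SEM_R \<Omega>) (power4_module (SEM_R \<Omega>)) (SEM \<Omega>)
           (\<lambda>(f0, f1, f2, f3).
              f0 \<oplus>\<^bsub>SEM \<Omega>\<^esub> f1 \<odot>\<^bsub>SEM \<Omega>\<^esub> sem_const \<Omega> I
                 \<oplus>\<^bsub>SEM \<Omega>\<^esub> f2 \<odot>\<^bsub>SEM \<Omega>\<^esub> sem_const \<Omega> J
                 \<oplus>\<^bsub>SEM \<Omega>\<^esub> f3 \<odot>\<^bsub>SEM \<Omega>\<^esub> sem_const \<Omega> K) \<and>
         vector_space_of_dim (SEM_R \<Omega>) (SEM \<Omega>) 4"
proof -
  note \<Omega> = circular_domainD[OF assms(1)]
  define e where "e k = [1, I, J, K] ! k" for k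
  have e [simp]: "e 0 = 1" "e 1 = I" "e (Suc 0) = I" "e 2 = J" "e 3 = K"
    by (simp_all add: e_def)
  have lt4: "{..<4::nat} = {0, 1, 2, 3}" by auto
  have inj: "inj_on e {..<4}"
    using assms(2) unfolding lt4 by (auto simp: inj_on_def)
  have img: "e ` {..<4} = {1, I, J, K}" unfolding lt4 by simp
  obtain l where l: "\<And>k. bounded_linear (l k)" "\<And>v. (\<Sum>k<4. l k v *\<^sub>R e k) = v"
    "\<And>j k. j < 4 \<Longrightarrow> k < 4 \<Longrightarrow> l j (e k) = (if j = k then 1 else 0)"
    using quat_basis_coordinates[OF inj] assms(3,4) unfolding img by blast
  define h where "h = (\<lambda>(f0, f1, f2, f3).
              f0 \<oplus>\<^bsub>SEM \<Omega>\<^esub> f1 \<odot>\<^bsub>SEM \<Omega>\<^esub> sem_const \<Omega> I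
                 \<oplus>\<^bsub>SEM \<Omega>\<^esub> f2 \<odot>\<^bsub>SEM \<Omega>\<^esub> sem_const \<Omega> J
                 \<oplus>\<^bsub>SEM \<Omega>\<^esub> f3 \<odot>\<^bsub>SEM \<Omega>\<^esub> sem_const \<Omega> K)"
  define R where "R = carrier (SEM_R \<Omega>)"
  note module = SEM_module[OF assms(1)]
  have E: "sem_const \<Omega> (e i) \<in> carrier (SEM \<Omega>)" for i
    unfolding sem_const_class by (intro sem_class_in_SEM sem_reps_const \<Omega>)
  have one: "a \<odot>\<^bsub>SEM \<Omega>\<^esub> sem_const \<Omega> 1 = a" if "a \<in> R" for a
  proof -
    obtain U f where "(U, f) \<in> sem_reps \<Omega>" "slice_preserving f U" "a = sem_class \<Omega> U f"
      using \<open>a \<in> R\<close> unfolding R_def by (rule SEM_R_cases[OF \<Omega>(2)])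
    then show ?thesis
      by (simp add: SEM_simps sem_const_class sem_mult_class \<Omega> sem_reps_const sem_reps_absorb)
  qed
  have h: "h (a0, a1, a2, a3) = sem_combination \<Omega> e ((!) [a0, a1, a2, a3])" if "a0 \<in> R" for a0 a1 a2 a3
    using one[OF that] by (simp add: h_def sem_combination_def)
  have bij: "bij_betw h (R \<times> R \<times> R \<times> R) (carrier (SEM \<Omega>))"
    unfolding bij_betw_def
  proof
    have nth: "[a0, a1, a2, a3] ! k \<in> R" if "a0 \<in> R" "a1 \<in> R" "a2 \<in> R" "a3 \<in> R" "k < 4" for a0 a1 a2 a3 k
      using that by (auto simp: eval_nat_numeral less_Suc_eq)
    show "inj_on h (R \<times> R \<times> R \<times> R)"
    proof (rule inj_onI)
      fix v w assume "v \<in> R \<times> R \<times> R \<times> R" "w \<in> R \<times> R \<times> R \<times> R" and hvw: "h v = h w"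
      then obtain a0 a1 a2 a3 b0 b1 b2 b3 where v: "v = (a0, a1, a2, a3)" "w = (b0, b1, b2, b3)"
        and R: "a0 \<in> R" "a1 \<in> R" "a2 \<in> R" "a3 \<in> R" "b0 \<in> R" "b1 \<in> R" "b2 \<in> R" "b3 \<in> R"
        by auto
      have eq: "sem_combination \<Omega> e ((!) [a0, a1, a2, a3]) = sem_combination \<Omega> e ((!) [b0, b1, b2, b3])"
        using hvw R by (simp add: h v)
      have "[a0, a1, a2, a3] ! k = [b0, b1, b2, b3] ! k" if "k < 4" for k
        by (rule sem_combination_inj[OF \<Omega>(1,2) l(1,3) _ _ eq that])
          (use nth R in \<open>auto simp: R_def[symmetric]\<close>)
      from this[of 0] this[of 1] this[of 2] this[of 3]
      show "v = w" by (simp add: v)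
    qed
    show "h ` (R \<times> R \<times> R \<times> R) = carrier (SEM \<Omega>)"
    proof (intro equalityI subsetI)
      fix B assume "B \<in> h ` (R \<times> R \<times> R \<times> R)"
      then obtain a0 a1 a2 a3 where a: "a0 \<in> R" "a1 \<in> R" "a2 \<in> R" "a3 \<in> R" "B = h (a0, a1, a2, a3)" by auto
      interpret Module.module "SEM_R \<Omega>" "SEM \<Omega>" by (rule module)
      show "B \<in> carrier (SEM \<Omega>)"
        using a E[of 1] E[of 2] E[of 3] SEM_R_subset[of \<Omega>] by (auto simp: h_def R_def)
    next
      fix B assume "B \<in> carrier (SEM \<Omega>)"
      then obtain A where A: "\<And>k. A k \<in> R" "sem_combination \<Omega> e A = B"
        using sem_combination_surj[OF \<Omega>(1,2) l(1,2)] unfolding R_def by metis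
      have "h (A 0, A 1, A 2, A 3) = B"
        using A by (simp add: h) (simp add: sem_combination_def)
      then show "B \<in> h ` (R \<times> R \<times> R \<times> R)" using A(1) by (intro image_eqI) auto
    qed
  qed
  have comb: "h (a0, a1, a2, a3) = a0 \<odot>\<^bsub>SEM \<Omega>\<^esub> sem_const \<Omega> (e 0) \<oplus>\<^bsub>SEM \<Omega>\<^esub> a1 \<odot>\<^bsub>SEM \<Omega>\<^esub> sem_const \<Omega> (e 1)
      \<oplus>\<^bsub>SEM \<Omega>\<^esub> a2 \<odot>\<^bsub>SEM \<Omega>\<^esub> sem_const \<Omega> (e 2) \<oplus>\<^bsub>SEM \<Omega>\<^esub> a3 \<odot>\<^bsub>SEM \<Omega>\<^esub> sem_const \<Omega> (e 3)"
    if "a0 \<in> carrier (SEM_R \<Omega>)" for a0 a1 a2 a3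
    using one that by (simp add: h_def R_def)
  have injE: "inj_on (\<lambda>i. sem_const \<Omega> (e i)) {..<4}"
  proof (rule inj_onI)
    fix i j assume "i \<in> {..<4::nat}" "j \<in> {..<4}" "sem_const \<Omega> (e i) = sem_const \<Omega> (e j)"
    then show "i = j"
      using inj_onD[OF inj, of i j] \<Omega>
      by (auto simp: sem_const_class sem_class_eq_iff sem_reps_const)
  qed
  note iso = linear_isomorphism_combination[OF module E comb bij[unfolded R_def]]
  note basis = module_basis_of_combination[OF module E injE comb bij[unfolded R_def]]
  show ?thesis
    using iso basis SEM_R_field[OF assms(1)] module
    unfolding vector_space_of_dim_def h_def by blast
qed

end
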